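(* Let $\vec k=(k_n,\dots,k_1)\in\{-1,0,1\}^n$. (a) For any $\varepsilon\in\mathbb C(v^{1/N})$, the coefficients in powers of $z$ of the linear combination $\mathbb T^v_{\vec k}(z)_{11}+\varepsilon\,\mathbb T^v_{\vec k}(z)_{22}$ generate a commutative subalgebra of $\mathcal A_n$. Moreover, they belong to the subalgebra $\mathcal C_n$ of $\mathcal A_n$. (b) $\mathbb T^v_{\vec k}(z)_{11}+\varepsilon\,\mathbb T^v_{\vec k}(z)_{22}=z^{-n}-\hat{\mathbb H}{}_2^{\vec k}z^{-n+1}+\text{higher powers of }z$, where $$\hat{\mathbb H}{}_2^{\vec k}=\sum_{i=1}^n(\mathsf w_i^2+\mathsf w_i^{-2})+\sum_{i=1}^{n-1}\bigl(\mathsf w_i^{-k_i-1}\mathsf w_{i+1}^{-k_{i+1}-1}+\mathsf w_i^{-k_i+1}\mathsf w_{i+1}^{-k_{i+1}+1}\bigr)\frac{\mathsf D_i}{\mathsf D_{i+1}}+v^{-k_n}\mathsf w_n^{-2k_n}\mathsf D_n^2$$ $$+\sum_{\substack{1\le i<j<n\\k_{i+1}=\dots=k_j=1}}\mathsf w_i^{-k_i-1}\cdots\mathsf w_{j+1}^{-k_{j+1}-1}\frac{\mathsf D_i}{\mathsf D_{j+1}}+\sum_{\substack{1\le i<n\\k_{i+1}=\dots=k_n=1}}v^{-1}\mathsf w_i^{-k_i-1}\cdots\mathsf w_n^{-k_n-1}\mathsf D_i\mathsf D_n$$ $$+\sum_{\substack{1\le i<j<n\\k_{i+1}=\dots=k_j=-1}}\mathsf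 w_i^{-k_i+1}\cdots\mathsf w_{j+1}^{-k_{j+1}+1}\frac{\mathsf D_i}{\mathsf D_{j+1}}+\sum_{\substack{1\le i<n\\k_{i+1}=\dots=k_n=-1}}v\,\mathsf w_i^{-k_i+1}\cdots\mathsf w_n^{-k_n+1}\mathsf D_i\mathsf D_n$$ $$+\varepsilon\Biggl(\delta_{n,1}(1-\delta_{k_1,0})\mathsf w_1^{-2k_1}+v^{k_1}\mathsf w_1^{-2k_1}\mathsf D_1^{-2}+\prod_{i=1}^n\delta_{k_i,1}\cdot\prod_{i=1}^n\mathsf w_i^{-2}\cdot\frac{\mathsf D_n}{\mathsf D_1}+\prod_{i=1}^n\delta_{k_i,-1}\cdot\prod_{i=1}^n\mathsf w_i^{2}\cdot\frac{\mathsf D_n}{\mathsf D_1}$$ $$+\sum_{\substack{1\le i<n\\k_1=\dots=k_i=1}}v\,\mathsf w_1^{-k_1-1}\cdots\mathsf w_{i+1}^{-k_{i+1}-1}\frac1{\mathsf D_1\mathsf D_{i+1}}+\sum_{\substack{1\le i<n\\k_1=\dots=k_i=-1}}v^{-1}\mathsf w_1^{-k_1+1}\cdots\mathsf w_{i+1}^{-k_{i+1}+1}\frac1{\mathsf D_1\mathsf D_{i+1}}\Biggr).$$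
   Context: $v$ is an indeterminate and the ground field is $\mathbb C(v^{1/N})$, $N$ a fixed positive integer. $\mathcal A_n$ is the associative $\mathbb C(v^{1/N})$-algebra generated by $\mathsf w_j^{\pm1},\mathsf D_j^{\pm1}$ ($1\le j\le n$) with $[\mathsf w_i,\mathsf w_j]=[\mathsf D_i,\mathsf D_j]=0$, $\mathsf w_i^{\pm1}\mathsf w_i^{\mp1}=\mathsf D_i^{\pm1}\mathsf D_i^{\mp1}=1$, $\mathsf D_i\mathsf w_j=v^{\delta_{ij}}\mathsf w_j\mathsf D_i$. $\mathcal C_n\subset\mathcal A_n$ is the subalgebra generated by $\mathsf w_j^{\pm1}$ ($1\le j\le n$), $(\mathsf D_i/\mathsf D_{i+1})^{\pm1}$ ($1\le i<n$), $\mathsf D_n^{\pm2}$. Local Lax matrices: $$L^{v,-1}_i(z)=\begin{pmatrix}\mathsf w_i^{-1}-\mathsf w_iz^{-1}&\mathsf w_i\mathsf D_i^{-1}\\-\mathsf w_i\mathsf D_iz^{-1}&\mathsf w_i\end{pmatrix},\quad L^{v,0}_i(z)=\begin{pmatrix}\mathsf w_i^{-1}z^{1/2}-\mathsf w_iz^{-1/2}&\mathsf D_i^{-1}z^{1/2}\\-\mathsf D_iz^{-1/2}&0\end{pmatrix},\quad L^{v,1}_i(z)=\begin{pmatrix}\mathsf w_i^{-1}z-\mathsf w_i&\mathsf w_i^{-1}\mathsf D_i^{-1}z\\-\mathsf w_i^{-1}\mathsf D_i&-\mathsf w_i^{-1}\end{pmatrix},$$ $$\bar L^{v,-1}_i(z)=\begin{pmatrix}\mathsf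 w_i-\mathsf w_i^{-1}z^{-1}&\mathsf w_i^{-1}\mathsf D_i\\-\mathsf w_i^{-1}\mathsf D_i^{-1}z^{-1}&\mathsf w_i^{-1}\end{pmatrix},\quad\bar L^{v,0}_i(z)=\begin{pmatrix}\mathsf w_iz^{1/2}-\mathsf w_i^{-1}z^{-1/2}&\mathsf D_iz^{1/2}\\-\mathsf D_i^{-1}z^{-1/2}&0\end{pmatrix},\quad\bar L^{v,1}_i(z)=\begin{pmatrix}\mathsf w_iz-\mathsf w_i^{-1}&\mathsf w_i\mathsf D_iz\\-\mathsf w_i\mathsf D_i^{-1}&-\mathsf w_i\end{pmatrix},$$ and $$\mathbb T^v_{\vec k}(z)=\bar L^{v,-k_1}_1(z)\cdots\bar L^{v,-k_n}_n(z)\,L^{v,k_n}_n(z)\cdots L^{v,k_1}_1(z).$$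
   Formalization: The two summands of the Hamiltonian containing D_n/D_1 are taken only for n > 1; as printed, for n = 1, k_1 = ±1 and ε ≠ 0 they duplicate the δ_{n,1} term w_1^{-2k_1}, which occurs only once in the actual expansion. *)

theory Defs
  imports
    "HOL-Analysis.Cartesian_Space"
    "HOL-Library.Poly_Mapping"
    "HOL-Computational_Algebra.Polynomial"
    "HOL-Computational_Algebra.Fraction_Field"
begin

section \<open>Ground field\<close>

text \<open>
  The ground field \<open>C(v^(1/N))\<close> is the field of rational functions in the single
  indeterminate \<open>t = v^(1/N)\<close>, so that \<open>v = t^N\<close>.  The positive integer \<open>N\<close> is the
  cardinality of a finite type \<open>'N\<close>.
\<close>

type_synonym ratfun = "complex poly fract"

definition vv :: "'N::finite itself \<Rightarrow> ratfun" where
  "vv _ = Fract [:0, 1:] 1 ^ CARD('N)"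

lemma vv_nonzero: "vv N \<noteq> 0"
proof -
  have "Fract [:0, 1:] 1 \<noteq> (0 :: ratfun)"
    by (simp add: Zero_fract_def eq_fract)
  then show ?thesis by (simp add: vv_def)
qed


section \<open>The algebra \<open>A_n\<close>, given by generators and relations\<close>

text \<open>
  The rank \<open>n\<close> is the cardinality of a finite type \<open>'n\<close>; the type \<open>'n idx\<close> is the index set
  \<open>{1, \<dots>, n}\<close>.
\<close>

typedef ('n::finite) idx = "{1..CARD('n)}"
proof
  show "1 \<in> {1..CARD('n)}"
    using zero_less_card_finite[where 'a = 'n] by simp
qed

datatype ('n::finite) gen = GW "'n idx" | GWinv "'n idx" | GD "'n idx" | GDinv "'n idx"

text \<open>
  Words form the free monoid (written additively, as \<open>Poly_Mapping\<close> requires), and its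
  monoid algebra is the free associative unital algebra on the generators.
\<close>

datatype 'g fword = Word "'g list"

instantiation fword :: (type) monoid_add
begin

definition zero_fword :: "'a fword" where "0 = Word []"

fun plus_fword :: "'a fword \<Rightarrow> 'a fword \<Rightarrow> 'a fword" where
  "Word x + Word y = Word (x @ y)"

instance
proof
  fix a b c :: "'a fword"
  show "a + b + c = a + (b + c)" by (cases a; cases b; cases c) simp
  show "0 + a = a" by (cases a) (simp add: zero_fword_def)
  show "a + 0 = a" by (cases a) (simp add: zero_fword_def)
qed

end

type_synonym 'n falg = "'n gen fword \<Rightarrow>\<^sub>0 ratfun"

definition fgen :: "'n::finite gen \<Rightarrow> 'n falg" where
  "fgen g = Poly_Mapping.single (Word [g]) 1"

definition fscal :: "ratfun \<Rightarrow> 'n::finite falg" where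
  "fscal c = Poly_Mapping.single 0 c"

inductive qrel :: "'N::finite itself \<Rightarrow> 'n::finite falg \<Rightarrow> 'n falg \<Rightarrow> bool"
  for N :: "'N itself" where
  ww: "qrel N (fgen (GW i) * fgen (GW j)) (fgen (GW j) * fgen (GW i))"
| DD: "qrel N (fgen (GD i) * fgen (GD j)) (fgen (GD j) * fgen (GD i))"
| w_winv: "qrel N (fgen (GW i) * fgen (GWinv i)) 1"
| winv_w: "qrel N (fgen (GWinv i) * fgen (GW i)) 1"
| D_Dinv: "qrel N (fgen (GD i) * fgen (GDinv i)) 1"
| Dinv_D: "qrel N (fgen (GDinv i) * fgen (GD i)) 1"
| Dw: "qrel N (fgen (GD i) * fgen (GW j))
         (fscal (vv N ^ (if i = j then 1 else 0)) * fgen (GW j) * fgen (GD i))"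
| refl: "qrel N x x"
| sym: "qrel N x y \<Longrightarrow> qrel N y x"
| trans: "qrel N x y \<Longrightarrow> qrel N y z \<Longrightarrow> qrel N x z"
| add: "qrel N x x' \<Longrightarrow> qrel N y y' \<Longrightarrow> qrel N (x + y) (x' + y')"
| mult: "qrel N x x' \<Longrightarrow> qrel N y y' \<Longrightarrow> qrel N (x * y) (x' * y')"

text \<open>
  The congruence does not collapse the algebra: the free algebra acts on \<open>K\<close>-valued functions
  on \<open>Z^n\<close>, the \<open>w_j\<close> by shifts and the \<open>D_j\<close> by multiplication operators, compatibly with the
  relations.  This gives \<open>1 \<noteq> 0\<close> in the quotient, which class \<open>ring_1\<close> demands.
\<close>

type_synonym 'n modl = "('n idx \<Rightarrow> int) \<Rightarrow> ratfun"

fun gact :: "'N::finite itself \<Rightarrow> 'n::finite gen \<Rightarrow> 'n modl \<Rightarrow> 'n modl" where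
  "gact N (GW j) g = (\<lambda>x. g (x(j := x j - 1)))"
| "gact N (GWinv j) g = (\<lambda>x. g (x(j := x j + 1)))"
| "gact N (GD j) g = (\<lambda>x. (vv N powi x j) * g x)"
| "gact N (GDinv j) g = (\<lambda>x. (vv N powi (- x j)) * g x)"

fun wact :: "'N::finite itself \<Rightarrow> 'n::finite gen fword \<Rightarrow> 'n modl \<Rightarrow> 'n modl" where
  "wact N (Word us) g = foldr (gact N) us g"

definition fact_on :: "'N::finite itself \<Rightarrow> 'n::finite falg \<Rightarrow> 'n modl \<Rightarrow> 'n modl" where
  "fact_on N f g = (\<lambda>x. \<Sum>u\<in>Poly_Mapping.keys f. Poly_Mapping.lookup f u * wact N u g x)"

lemma wact_plus: "wact N (u + w) g = wact N u (wact N w g)"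
  by (cases u; cases w) simp

lemma wact_zero: "wact N 0 g = g"
  by (simp add: zero_fword_def)

lemma gact_add: "gact N a (\<lambda>x. g x + h x) = (\<lambda>x. gact N a g x + gact N a h x)"
  by (cases a) (auto simp: algebra_simps)

lemma gact_scale: "gact N a (\<lambda>x. c * g x) = (\<lambda>x. c * gact N a g x)"
  by (cases a) (auto simp: algebra_simps)

lemma wact_add: "wact N u (\<lambda>x. g x + h x) = (\<lambda>x. wact N u g x + wact N u h x)"
proof (cases u)
  case (Word us)
  have "foldr (gact N) us (\<lambda>x. g x + h x)
      = (\<lambda>x. foldr (gact N) us g x + foldr (gact N) us h x)"
    by (induction us) (simp_all add: gact_add)
  then show ?thesis using Word by simp
qed

lemma wact_scale: "wact N u (\<lambda>x. c * g x) = (\<lambda>x. c * wact N u g x)"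
proof (cases u)
  case (Word us)
  have "foldr (gact N) us (\<lambda>x. c * g x) = (\<lambda>x. c * foldr (gact N) us g x)"
    by (induction us) (simp_all add: gact_scale)
  then show ?thesis using Word by simp
qed

lemma fact_on_superset:
  assumes "finite S" "Poly_Mapping.keys f \<subseteq> S"
  shows "fact_on N f g x = (\<Sum>u\<in>S. Poly_Mapping.lookup f u * wact N u g x)"
  unfolding fact_on_def
  by (rule sum.mono_neutral_left) (use assms in \<open>auto simp: in_keys_iff\<close>)

lemma fact_on_plus: "fact_on N (f + f') g = (\<lambda>x. fact_on N f g x + fact_on N f' g x)"
proof
  fix x
  let ?S = "Poly_Mapping.keys f \<union> Poly_Mapping.keys f'"
  have "fact_on N (f + f') g x
      = (\<Sum>u\<in>?S. Poly_Mapping.lookup (f + f') u * wact N u g x)"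
    by (rule fact_on_superset) (auto simp: Poly_Mapping.keys_add)
  also have "\<dots> = fact_on N f g x + fact_on N f' g x"
    by (simp add: fact_on_superset[of ?S] lookup_add distrib_right sum.distrib)
  finally show "fact_on N (f + f') g x = fact_on N f g x + fact_on N f' g x" .
qed

lemma fact_on_single:
  "fact_on N (Poly_Mapping.single u c) g = (\<lambda>x. c * wact N u g x)"
  by (auto simp: fact_on_def)

lemma fact_on_zero: "fact_on N 0 g = (\<lambda>x. 0)"
  by (simp add: fact_on_def)

lemma fact_on_one: "fact_on N 1 g = g"
  using fact_on_single[of N 0 1 g] by (simp add: wact_zero single_one)

lemma fact_on_add_arg: "fact_on N f (\<lambda>x. g x + h x) = (\<lambda>x. fact_on N f g x + fact_on N f h x)"
  by (simp add: fact_on_def wact_add distrib_left sum.distrib)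

lemma falg_induct:
  fixes f :: "'n::finite falg"
  assumes "P 0" "\<And>u c f. P f \<Longrightarrow> P (Poly_Mapping.single u c + f)"
  shows "P f"
proof -
  have "P g" if "Poly_Mapping.keys g \<subseteq> S" "finite S" for S g
    using that(2,1)
  proof (induction S arbitrary: g rule: finite_induct)
    case empty
    then have "g = 0" by simp
    then show ?case using assms(1) by simp
  next
    case (insert u S)
    let ?s = "Poly_Mapping.single u (Poly_Mapping.lookup g u)"
    have "Poly_Mapping.keys (g - ?s) \<subseteq> S"
      using insert.prems by (auto simp: in_keys_iff lookup_minus lookup_single when_def split: if_splits)
    then have "P (?s + (g - ?s))" by (intro assms(2) insert.IH)
    then show ?case by simp
  qed
  then show ?thesis using finite_keys by blast
qed

lemma fact_on_single_mult:
  "fact_on N (Poly_Mapping.single u c * f) g = fact_on N (Poly_Mapping.single u c) (fact_on N f g)"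
proof (induction f rule: falg_induct)
  case 1
  have "wact N u (\<lambda>x. 0) = (\<lambda>x. 0)" using wact_scale[of N u 0] by simp
  then show ?case by (simp add: fact_on_zero fact_on_single)
next
  case (2 w d f)
  then show ?case
    by (simp add: distrib_left fact_on_plus fact_on_add_arg mult_single)
       (simp add: fact_on_single wact_plus wact_scale mult.assoc)
qed

lemma fact_on_mult: "fact_on N (f * f') g = fact_on N f (fact_on N f' g)"
proof (induction f rule: falg_induct)
  case 1
  then show ?case by (simp add: fact_on_zero)
next
  case (2 u c f)
  then show ?case by (simp add: distrib_right fact_on_plus fact_on_single_mult)
qed

lemma qrel_fact_on: "qrel N f f' \<Longrightarrow> fact_on N f g = fact_on N f' g"
proof (induction arbitrary: g rule: qrel.induct)
  case (Dw i j)
  have N: "vv N \<noteq> 0" by (rule vv_nonzero)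
  show ?case
    by (auto simp: fact_on_mult fgen_def fscal_def fact_on_single wact_zero fun_eq_iff
        power_int_diff N)
next
  case (ww i j)
  show ?case
    by (cases "i = j")
       (auto simp: fact_on_mult fgen_def fact_on_single fact_on_one fun_upd_twist)
next
  case (D_Dinv i)
  have N: "vv N \<noteq> 0" by (rule vv_nonzero)
  then show ?case
    by (auto simp: fact_on_mult fgen_def fact_on_single fact_on_one power_int_minus)
next
  case (Dinv_D i)
  have N: "vv N \<noteq> 0" by (rule vv_nonzero)
  then show ?case
    by (auto simp: fact_on_mult fgen_def fact_on_single fact_on_one power_int_minus)
qed (auto simp: fact_on_mult fgen_def fact_on_single fact_on_one fact_on_plus)

lemma not_qrel_zero_one: "\<not> qrel N 0 (1 :: 'n::finite falg)"
proof
  assume "qrel N 0 (1 :: 'n falg)"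
  from qrel_fact_on[OF this, of "\<lambda>x. 1"] have "(\<lambda>x::'n idx \<Rightarrow> int. 0::ratfun) = (\<lambda>x. 1)"
    by (simp add: fact_on_zero fact_on_one)
  then show False by (simp add: fun_eq_iff)
qed

quotient_type ('n, 'N) qalg = "'n::finite falg" / "qrel TYPE('N::finite)"
  by (rule equivpI) (auto simp: reflp_def symp_def transp_def intro: qrel.intros)

instantiation qalg :: (finite, finite) ring_1
begin

lift_definition zero_qalg :: "('a, 'b) qalg" is 0 .
lift_definition one_qalg :: "('a, 'b) qalg" is 1 .
lift_definition plus_qalg :: "('a, 'b) qalg \<Rightarrow> ('a, 'b) qalg \<Rightarrow> ('a, 'b) qalg" is "(+)"
  by (rule qrel.add)
lift_definition times_qalg :: "('a, 'b) qalg \<Rightarrow> ('a, 'b) qalg \<Rightarrow> ('a, 'b) qalg" is "(*)"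
  by (rule qrel.mult)
lift_definition uminus_qalg :: "('a, 'b) qalg \<Rightarrow> ('a, 'b) qalg" is "uminus"
  using qrel.mult[OF qrel.refl[where x = "- 1"]] by force
lift_definition minus_qalg :: "('a, 'b) qalg \<Rightarrow> ('a, 'b) qalg \<Rightarrow> ('a, 'b) qalg" is "(-)"
proof -
  fix x x' y y' :: "'a falg"
  assume "qrel TYPE('b) x x'" "qrel TYPE('b) y y'"
  from qrel.add[OF this(1) qrel.mult[OF qrel.refl[where x = "- 1"] this(2)]]
  show "qrel TYPE('b) (x - y) (x' - y')" by simp
qed

instance
proof
  fix a b c :: "('a, 'b) qalg"
  show "a + b + c = a + (b + c)" by transfer (simp add: add.assoc qrel.refl)
  show "a + b = b + a" by transfer (simp add: add.commute qrel.refl)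
  show "0 + a = a" by transfer (simp add: qrel.refl)
  show "- a + a = 0" by transfer (simp add: qrel.refl)
  show "a - b = a + - b" by transfer (simp add: qrel.refl)
  show "a * b * c = a * (b * c)" by transfer (simp add: mult.assoc qrel.refl)
  show "(a + b) * c = a * c + b * c" by transfer (simp add: distrib_right qrel.refl)
  show "a * (b + c) = a * b + a * c" by transfer (simp add: distrib_left qrel.refl)
  show "1 * a = a" by transfer (simp add: qrel.refl)
  show "a * 1 = a" by transfer (simp add: qrel.refl)
  show "(0 :: ('a, 'b) qalg) \<noteq> 1" by transfer (rule not_qrel_zero_one)
qed

end

lift_definition scal :: "ratfun \<Rightarrow> ('n::finite, 'N::finite) qalg" is fscal .

lift_definition gen_elt :: "'n::finite gen \<Rightarrow> ('n, 'N::finite) qalg" is fgen .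

text \<open>
  Integer powers of \<open>w_j\<close> and \<open>D_j\<close>, meaningful for \<open>1 \<le> j \<le> n\<close> only
  (elsewhere \<open>Abs_idx j\<close> is unspecified).
\<close>

definition w_pow :: "nat \<Rightarrow> int \<Rightarrow> ('n::finite, 'N::finite) qalg" where
  "w_pow j m = (if m \<ge> 0 then gen_elt (GW (Abs_idx j)) ^ nat m
                else gen_elt (GWinv (Abs_idx j)) ^ nat (- m))"

definition D_pow :: "nat \<Rightarrow> int \<Rightarrow> ('n::finite, 'N::finite) qalg" where
  "D_pow j m = (if m \<ge> 0 then gen_elt (GD (Abs_idx j)) ^ nat m
                else gen_elt (GDinv (Abs_idx j)) ^ nat (- m))"


section \<open>Subalgebras\<close>

inductive_set subalgebra_gen ::
  "('n::finite, 'N::finite) qalg set \<Rightarrow> ('n, 'N) qalg set" for S where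
  base: "x \<in> S \<Longrightarrow> x \<in> subalgebra_gen S"
| scalar: "scal c \<in> subalgebra_gen S"
| add: "x \<in> subalgebra_gen S \<Longrightarrow> y \<in> subalgebra_gen S \<Longrightarrow> x + y \<in> subalgebra_gen S"
| mult: "x \<in> subalgebra_gen S \<Longrightarrow> y \<in> subalgebra_gen S \<Longrightarrow> x * y \<in> subalgebra_gen S"

definition C_alg :: "('n::finite, 'N::finite) qalg set" where
  "C_alg = (let n = CARD('n) in subalgebra_gen
     ({w_pow j s | j s. j \<in> {1..n} \<and> s \<in> {1, -1}}
      \<union> {D_pow i s * D_pow (i + 1) (- s) | i s. 1 \<le> i \<and> i < n \<and> s \<in> {1, -1}}
      \<union> {D_pow n 2, D_pow n (- 2)}))"


section \<open>Lax matrices and the complete monodromy matrix\<close>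

text \<open>
  Laurent polynomials in \<open>z^(1/2)\<close> with coefficients in \<open>A_n\<close> (\<open>z\<close> is central).  Exponents
  are counted in units of one half: \<open>zmon a m\<close> is \<open>a z^(m/2)\<close>.
\<close>

type_synonym ('n, 'N) zpoly = "int \<Rightarrow>\<^sub>0 ('n, 'N) qalg"

abbreviation zmon :: "('n::finite, 'N::finite) qalg \<Rightarrow> int \<Rightarrow> ('n, 'N) zpoly" where
  "zmon a m \<equiv> Poly_Mapping.single m a"

definition mat2 :: "'a::zero \<Rightarrow> 'a \<Rightarrow> 'a \<Rightarrow> 'a \<Rightarrow> 'a ^ 2 ^ 2" where
  "mat2 a b c d = vector [vector [a, b], vector [c, d]]"

text \<open>The second argument is the superscript; only the values \<open>-1, 0, 1\<close> are used.\<close>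

definition Lax :: "nat \<Rightarrow> int \<Rightarrow> ('n::finite, 'N::finite) zpoly ^ 2 ^ 2" where
  "Lax i s =
    (if s = - 1 then
       mat2 (zmon (w_pow i (-1)) 0 - zmon (w_pow i 1) (-2))  (zmon (w_pow i 1 * D_pow i (-1)) 0)
            (- zmon (w_pow i 1 * D_pow i 1) (-2))            (zmon (w_pow i 1) 0)
     else if s = 0 then
       mat2 (zmon (w_pow i (-1)) 1 - zmon (w_pow i 1) (-1))  (zmon (D_pow i (-1)) 1)
            (- zmon (D_pow i 1) (-1))                        0
     else
       mat2 (zmon (w_pow i (-1)) 2 - zmon (w_pow i 1) 0)     (zmon (w_pow i (-1) * D_pow i (-1)) 2)
            (- zmon (w_pow i (-1) * D_pow i 1) 0)            (- zmon (w_pow i (-1)) 0))"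

definition Lax_bar :: "nat \<Rightarrow> int \<Rightarrow> ('n::finite, 'N::finite) zpoly ^ 2 ^ 2" where
  "Lax_bar i s =
    (if s = - 1 then
       mat2 (zmon (w_pow i 1) 0 - zmon (w_pow i (-1)) (-2))  (zmon (w_pow i (-1) * D_pow i 1) 0)
            (- zmon (w_pow i (-1) * D_pow i (-1)) (-2))      (zmon (w_pow i (-1)) 0)
     else if s = 0 then
       mat2 (zmon (w_pow i 1) 1 - zmon (w_pow i (-1)) (-1))  (zmon (D_pow i 1) 1)
            (- zmon (D_pow i (-1)) (-1))                     0
     else
       mat2 (zmon (w_pow i 1) 2 - zmon (w_pow i (-1)) 0)     (zmon (w_pow i 1 * D_pow i 1) 2)
            (- zmon (w_pow i 1 * D_pow i (-1)) 0)            (- zmon (w_pow i 1) 0))"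

definition monodromy :: "(nat \<Rightarrow> int) \<Rightarrow> ('n::finite, 'N::finite) zpoly ^ 2 ^ 2" where
  "monodromy k = (let n = CARD('n) in
     foldr (**) (map (\<lambda>i. Lax_bar i (- k i)) [1..<Suc n]
                 @ map (\<lambda>i. Lax i (k i)) (rev [1..<Suc n])) (mat 1))"

definition T_comb :: "(nat \<Rightarrow> int) \<Rightarrow> ratfun \<Rightarrow> ('n::finite, 'N::finite) zpoly" where
  "T_comb k \<epsilon> = monodromy k $ 1 $ 1 + zmon (scal \<epsilon>) 0 * monodromy k $ 2 $ 2"


section \<open>The Hamiltonian\<close>

definition w_prod :: "nat \<Rightarrow> nat \<Rightarrow> (nat \<Rightarrow> int) \<Rightarrow> ('n::finite, 'N::finite) qalg" where
  "w_prod i j e = prod_list (map (\<lambda>l. w_pow l (e l)) [i..<Suc j])"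

text \<open>
  Correction: the two summands with \<open>D_n / D_1\<close> carry the condition \<open>n > 1\<close>, absent from the
  published formula.  For \<open>n = 1\<close> and \<open>k_1 = 1\<close> or \<open>k_1 = -1\<close> such a summand would be
  \<open>w_1^(-2 k_1)\<close>, which the summand with the factor \<open>\<delta>_(n,1)\<close> already contributes, whereas
  multiplying out the two Lax matrices gives this monomial only once.
\<close>

definition H2hat :: "(nat \<Rightarrow> int) \<Rightarrow> ratfun \<Rightarrow> ('n::finite, 'N::finite) qalg" where
  "H2hat k \<epsilon> = (let n = CARD('n); v = vv TYPE('N) in
      (\<Sum>i=1..n. w_pow i 2 + w_pow i (- 2))
    + (\<Sum>i\<in>{1..<n}. (w_pow i (- k i - 1) * w_pow (i + 1) (- k (i + 1) - 1)
                     + w_pow i (- k i + 1) * w_pow (i + 1) (- k (i + 1) + 1))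
                    * (D_pow i 1 * D_pow (i + 1) (- 1)))
    + scal (v powi (- k n)) * w_pow n (- 2 * k n) * D_pow n 2
    + (\<Sum>(i, j)\<in>{(i, j). 1 \<le> i \<and> i < j \<and> j < n \<and> (\<forall>l\<in>{i + 1..j}. k l = 1)}.
         w_prod i (j + 1) (\<lambda>l. - k l - 1) * (D_pow i 1 * D_pow (j + 1) (- 1)))
    + (\<Sum>i\<in>{i. 1 \<le> i \<and> i < n \<and> (\<forall>l\<in>{i + 1..n}. k l = 1)}.
         scal (v powi (- 1)) * w_prod i n (\<lambda>l. - k l - 1) * (D_pow i 1 * D_pow n 1))
    + (\<Sum>(i, j)\<in>{(i, j). 1 \<le> i \<and> i < j \<and> j < n \<and> (\<forall>l\<in>{i + 1..j}. k l = - 1)}.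
         w_prod i (j + 1) (\<lambda>l. - k l + 1) * (D_pow i 1 * D_pow (j + 1) (- 1)))
    + (\<Sum>i\<in>{i. 1 \<le> i \<and> i < n \<and> (\<forall>l\<in>{i + 1..n}. k l = - 1)}.
         scal v * w_prod i n (\<lambda>l. - k l + 1) * (D_pow i 1 * D_pow n 1))
    + scal \<epsilon> *
      ( (if n = 1 \<and> k 1 \<noteq> 0 then w_pow 1 (- 2 * k 1) else 0)
      + scal (v powi (k 1)) * w_pow 1 (- 2 * k 1) * D_pow 1 (- 2)
      + (if n > 1 \<and> (\<forall>i\<in>{1..n}. k i = 1)
         then w_prod 1 n (\<lambda>_. - 2) * (D_pow n 1 * D_pow 1 (- 1)) else 0)
      + (if n > 1 \<and> (\<forall>i\<in>{1..n}. k i = - 1)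
         then w_prod 1 n (\<lambda>_. 2) * (D_pow n 1 * D_pow 1 (- 1)) else 0)
      + (\<Sum>i\<in>{i. 1 \<le> i \<and> i < n \<and> (\<forall>l\<in>{1..i}. k l = 1)}.
           scal v * w_prod 1 (i + 1) (\<lambda>l. - k l - 1) * (D_pow 1 (- 1) * D_pow (i + 1) (- 1)))
      + (\<Sum>i\<in>{i. 1 \<le> i \<and> i < n \<and> (\<forall>l\<in>{1..i}. k l = - 1)}.
           scal (v powi (- 1)) * w_prod 1 (i + 1) (\<lambda>l. - k l + 1)
             * (D_pow 1 (- 1) * D_pow (i + 1) (- 1)))))"

end

theory Submission
  imports Defs "HOL-Library.Product_Plus"
begin

text \<open>
  After clearing half-integral powers of \<open>z\<close>, the local Lax matrices satisfy the RLL relation for the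
  six-vertex R-matrix, and a matrix \<open>L_i\<close> and its partner \<open>L'_i\<close> satisfy the crossed exchange relation.
  Since different sites commute, dressing \<open>U \<mapsto> L'_i U L_i\<close> preserves Sklyanin's reflection equation
  \<open>R(z/y) U_1(z) S(zy) U_2(y) = U_2(y) S(zy) U_1(z) R(z/y)\<close>, so the monodromy matrix satisfies it.
  Its diagonal entries say that \<open>[A(z), A(y)] = 0 = [D(z), D(y)]\<close>, and six of its entries combine to
  \<open>[A(z), D(y)] + [D(z), A(y)] = 0\<close>, in each case up to a product of binomials in \<open>z\<close> and \<open>y\<close>, which are
  not zero divisors; hence \<open>A + \<epsilon> D\<close> commutes with itself at different arguments.

  Diagonal entries of all Lax matrices have even degree in the \<open>D_j\<close>, off-diagonal ones odd degree,
  so diagonal entries of the product lie in \<open>C_n\<close>.  The two lowest coefficients in \<open>z\<close> obey a recursion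
  in the innermost-to-outermost order of the sites, which is solved by the sums in the Hamiltonian.
\<close>

section \<open>The R-matrix and the reflection equation\<close>

text \<open>Two features of the setting shape the argument. And the spectral parameters z and y are
  central elements of one ring, in the end Laurent polynomials in two variables over A_n, so a
  common factor may be cancelled only once it is known not to be a zero divisor. The usual route
  from the reflection equation to commuting traces goes through a dual reflection equation and
  crossing unitarity. Here the twist is the diagonal matrix with entries 1 and \<epsilon>, and an
  explicit elimination takes the place of that machinery. Commutativity of A + \<epsilon> D splits
  by powers of \<epsilon> into three identities, of which only the linear one mixes A and D. For the
  lowest coefficients the point is closure: the constant coefficient matrix of an inner monodromy
  has zero second column, and therefore very few coefficients pass from one site to the
  next.\<close>

lemma mat2_nth [simp]:
  "mat2 a b c d $ 1 $ 1 = a" "mat2 a b c d $ 1 $ 2 = b"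
  "mat2 a b c d $ 2 $ 1 = c" "mat2 a b c d $ 2 $ 2 = d"
  by (simp_all add: mat2_def)

lemma sum_UNIV_2x2:
  "(\<Sum>p\<in>UNIV. f p) = f (1, 1) + f (1, 2) + f (2, 1) + f ((2, 2) :: 2 \<times> 2)"
  by (simp only: UNIV_Times_UNIV[symmetric] sum.cartesian_product' sum_2 ac_simps)

lemma all_2x2:
  "(\<forall>p :: 2 \<times> 2. P p) \<longleftrightarrow> P (1, 1) \<and> P (1, 2) \<and> P (2, 1) \<and> P (2, 2)"
  by (simp add: split_paired_All forall_2)

section \<open>Matrices acting on the first or on the second factor of a tensor square\<close>

definition leg1 :: "'r::ring_1 ^ 2 ^ 2 \<Rightarrow> 'r ^ (2 \<times> 2) ^ (2 \<times> 2)" where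
  "leg1 A = (\<chi> p q. if snd p = snd q then A $ fst p $ fst q else 0)"

definition leg2 :: "'r::ring_1 ^ 2 ^ 2 \<Rightarrow> 'r ^ (2 \<times> 2) ^ (2 \<times> 2)" where
  "leg2 A = (\<chi> p q. if fst p = fst q then A $ snd p $ snd q else 0)"

lemma one_neq_two [simp]: "(1 :: 2) \<noteq> 2" "(2 :: 2) \<noteq> 1"
  by simp_all

lemma leg_sum: "(leg1 A ** leg2 B) $ p $ r = A $ fst p $ fst r * B $ snd p $ snd r"
  "(leg2 B ** leg1 A) $ p $ r = B $ snd p $ snd r * A $ fst p $ fst r"
  by (cases p; cases r; simp add: leg1_def leg2_def matrix_matrix_mult_def sum_UNIV_2x2;
    metis (full_types) exhaust_2 add.left_neutral add.right_neutral one_neq_two)+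

lemma leg1_mult_nth: "(leg1 A ** M) $ p $ r = (\<Sum>a\<in>UNIV. A $ fst p $ a * M $ (a, snd p) $ r)"
  using exhaust_2[of "snd p"]
  by (auto simp add: leg1_def matrix_matrix_mult_def sum_UNIV_2x2 sum_2)

lemma mult_leg2_nth: "(M ** leg2 A) $ p $ r = (\<Sum>a\<in>UNIV. M $ p $ (fst r, a) * A $ a $ snd r)"
  using exhaust_2[of "fst r"]
  by (auto simp add: leg2_def matrix_matrix_mult_def sum_UNIV_2x2 sum_2)

lemma leg2_mult_nth: "(leg2 A ** M) $ p $ r = (\<Sum>a\<in>UNIV. A $ snd p $ a * M $ (fst p, a) $ r)"
  using exhaust_2[of "fst p"]
  by (auto simp add: leg2_def matrix_matrix_mult_def sum_UNIV_2x2 sum_2)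

lemma mult_leg1_nth: "(M ** leg1 A) $ p $ r = (\<Sum>a\<in>UNIV. M $ p $ (a, snd r) * A $ a $ fst r)"
  using exhaust_2[of "snd r"]
  by (auto simp add: leg1_def matrix_matrix_mult_def sum_UNIV_2x2 sum_2)

definition central :: "'r::ring_1 \<Rightarrow> bool" where
  "central c \<longleftrightarrow> (\<forall>x. c * x = x * c)"

lemma central_left_commute: "central c \<Longrightarrow> x * (c * y) = c * (x * y)"
  by (metis central_def mult.assoc)

lemma centralD: "central c \<Longrightarrow> x * c = c * x"
  by (simp add: central_def)

text \<open>
  \<open>Rmat\<close> is the trigonometric six-vertex R-matrix \<open>R(z/y)\<close> with the common denominator cleared,
  and \<open>Smat\<close> its crossed version, which depends on the product \<open>z y\<close> only.
\<close>

locale reflection_params =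
  fixes q z y :: "'r::ring_1"
  assumes central_q: "central q" and central_z: "central z" and central_y: "central y"
begin

definition Rmat :: "'r ^ (2 \<times> 2) ^ (2 \<times> 2)" where
  "Rmat = (\<chi> p r.
     if p = r then if fst p = snd p then q * q * z - y else q * (z - y)
     else if p = (1, 2) \<and> r = (2, 1) then (q * q - 1) * z
     else if p = (2, 1) \<and> r = (1, 2) then (q * q - 1) * y
     else 0)"

definition Smat :: "'r ^ (2 \<times> 2) ^ (2 \<times> 2)" where
  "Smat = (\<chi> p r.
     if p = r then if fst p = snd p then q * q - z * y else q * (1 - z * y)
     else if p = (1, 1) \<and> r = (2, 2) then (q * q - 1) * (z * y)
     else if p = (2, 2) \<and> r = (1, 1) then q * q - 1
     else 0)"

lemma Rmat_mult_nth:
  "(Rmat ** M) $ (1, 1) $ r = (q * q * z - y) * M $ (1, 1) $ r"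
  "(Rmat ** M) $ (2, 2) $ r = (q * q * z - y) * M $ (2, 2) $ r"
  "(Rmat ** M) $ (1, 2) $ r = q * (z - y) * M $ (1, 2) $ r + (q * q - 1) * z * M $ (2, 1) $ r"
  "(Rmat ** M) $ (2, 1) $ r = (q * q - 1) * y * M $ (1, 2) $ r + q * (z - y) * M $ (2, 1) $ r"
  by (simp_all add: Rmat_def matrix_matrix_mult_def sum_UNIV_2x2)

lemma mult_Rmat_nth:
  "(M ** Rmat) $ p $ (1, 1) = M $ p $ (1, 1) * (q * q * z - y)"
  "(M ** Rmat) $ p $ (2, 2) = M $ p $ (2, 2) * (q * q * z - y)"
  "(M ** Rmat) $ p $ (1, 2) = M $ p $ (1, 2) * (q * (z - y)) + M $ p $ (2, 1) * ((q * q - 1) * y)"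
  "(M ** Rmat) $ p $ (2, 1) = M $ p $ (1, 2) * ((q * q - 1) * z) + M $ p $ (2, 1) * (q * (z - y))"
  by (simp_all add: Rmat_def matrix_matrix_mult_def sum_UNIV_2x2)

lemma Smat_nth:
  "Smat $ (a, b) $ (c, e) =
    (if a = c \<and> b = e then if a = b then q * q - z * y else q * (1 - z * y)
     else if a = 1 \<and> b = 1 \<and> c = 2 \<and> e = 2 then (q * q - 1) * (z * y)
     else if a = 2 \<and> b = 2 \<and> c = 1 \<and> e = 1 then q * q - 1 else 0)"
  by (simp add: Smat_def)

lemma leg1_Smat_leg2:
  "(leg1 A ** Smat ** leg2 B) $ p $ r =
    (\<Sum>m\<in>UNIV. \<Sum>a\<in>UNIV. A $ fst p $ a * Smat $ (a, snd p) $ (fst r, m) * B $ m $ snd r)"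
  by (simp add: mult_leg2_nth leg1_mult_nth sum_distrib_right)

lemma leg2_Smat_leg1:
  "(leg2 B ** Smat ** leg1 A) $ p $ r =
    (\<Sum>m\<in>UNIV. \<Sum>a\<in>UNIV. B $ snd p $ a * Smat $ (fst p, a) $ (m, snd r) * A $ m $ fst r)"
  by (simp add: mult_leg1_nth leg2_mult_nth sum_distrib_right)

end

section \<open>Exchange relations of a single site\<close>

locale weyl_pair =
  fixes q q' w w' d d' :: "'r::ring_1"
  assumes q: "central q" "central q'" "q * q' = 1"
    and inv: "w * w' = 1" "w' * w = 1" "d * d' = 1" "d' * d = 1"
    and dw: "d * w = q * (w * d)"
begin

lemma dw': "d * w' = q' * (w' * d)"
proof -
  have "w' * d = w' * d * w * w'" by (simp add: mult.assoc inv)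
  also have "\<dots> = q * (d * w')"
    by (simp add: mult.assoc dw central_left_commute[OF q(1)])
       (metis inv(2) mult.assoc mult_1)
  finally show ?thesis using q by (metis central_def mult.assoc mult_1)
qed

end

text \<open>Inverting \<open>d\<close> and inverting \<open>w\<close> each turn q into its inverse,
  so inverting both restores q. This symmetry carries relations of the unbarred matrices over to the
  barred ones.\<close>

lemma weyl_pair_swap:
  assumes "weyl_pair q q' w w' d d'" shows "weyl_pair q q' w' w d' d"
proof -
  interpret weyl_pair q q' w w' d d' by fact
  have "q * (w' * d') = d' * (d * (q * (w' * d')))" by (simp add: mult.assoc[symmetric] inv)
  also have "\<dots> = d' * w' * (d * d')"
    by (metis (no_types, lifting) central_left_commute dw' mult.assoc mult_1 q(1) q(3))
  finally show ?thesis using q inv by unfold_locales (simp_all add: inv)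
qed

context weyl_pair
begin

lemma swap_rules:
  "d * w = q * (w * d)" "d * w' = q' * (w' * d)" "d' * w = q' * (w * d')" "d' * w' = q * (w' * d')"
  using dw dw' weyl_pair.dw[OF weyl_pair_swap[OF weyl_pair_axioms]]
    weyl_pair.dw'[OF weyl_pair_swap[OF weyl_pair_axioms]] by auto

lemma mult_assoc_rule: "x * y = t \<Longrightarrow> x * (y * u) = t * (u::'r)"
  by (metis mult.assoc)

text \<open>A normal form: scalars first, then \<open>w\<close> and \<open>w'\<close>, then
  \<open>d\<close> and \<open>d'\<close>. Each rule comes with a variant that acts inside a product
  bracketed to the right.\<close>

lemmas weyl_normal =
  swap_rules swap_rules[THEN mult_assoc_rule] inv inv[THEN mult_assoc_rule] q(3) q(3)[THEN mult_assoc_rule]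
  q(1)[THEN centralD, of q'] q(1)[THEN central_left_commute, of q']
  q(1-2)[THEN centralD, of w] q(1-2)[THEN central_left_commute, of w]
  q(1-2)[THEN centralD, of w'] q(1-2)[THEN central_left_commute, of w']
  q(1-2)[THEN centralD, of d] q(1-2)[THEN central_left_commute, of d]
  q(1-2)[THEN centralD, of d'] q(1-2)[THEN central_left_commute, of d']
  distrib_left distrib_right left_diff_distrib right_diff_distrib mult.assoc
  mult_minus_left mult_minus_right mult_1_left mult_1_right mult_zero_left mult_zero_right

end

text \<open>
  This is \<open>z^((1-s)/2)\<close> times the matrix \<open>L^(v,s)(z)\<close>, which removes the half-integral powers; exchanging
  \<open>w\<close> with \<open>w'\<close> and \<open>d\<close> with \<open>d'\<close> turns \<open>L\<close> into the barred matrix.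
\<close>

definition lax_core :: "int \<Rightarrow> 'r::ring_1 \<Rightarrow> 'r \<Rightarrow> 'r \<Rightarrow> 'r \<Rightarrow> 'r \<Rightarrow> 'r ^ 2 ^ 2" where
  "lax_core s z w w' d d' =
    (if s = - 1 then mat2 (z * w' - w) (z * (w * d')) (- (w * d)) (z * w)
     else if s = 0 then mat2 (z * w' - w) (z * d') (- d) 0
     else mat2 (z * w' - w) (z * (w' * d')) (- (w' * d)) (- w'))"

locale lax_pair = reflection_params q z y + weyl_pair q q' w w' d d'
  for q q' z y w w' d d' :: "'r::ring_1"
begin

lemma swap: "lax_pair q q' z y w' w d' d"
  using weyl_pair_swap[OF weyl_pair_axioms] reflection_params_axioms
  by (simp add: lax_pair_def)

lemmas scalars = central_z central_y

lemmas lax_normal = weyl_normal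
  central_z[THEN centralD, of y] central_z[THEN central_left_commute, of y]
  scalars[THEN centralD, of q] scalars[THEN central_left_commute, of q]
  scalars[THEN centralD, of q'] scalars[THEN central_left_commute, of q']
  scalars[THEN centralD, of w] scalars[THEN central_left_commute, of w]
  scalars[THEN centralD, of w'] scalars[THEN central_left_commute, of w']
  scalars[THEN centralD, of d] scalars[THEN central_left_commute, of d]
  scalars[THEN centralD, of d'] scalars[THEN central_left_commute, of d']

text \<open>For each of the 16 entries and each value of s, both sides have the same ordered normal
  form; the q of the R-matrix is the one in \<open>d * w = q * (w * d)\<close>.\<close>

lemma RLL:
  assumes "s \<in> {-1, 0, 1}"
  shows "Rmat ** (leg1 (lax_core s z w w' d d') ** leg2 (lax_core s y w w' d d'))
    = leg2 (lax_core s y w w' d d') ** leg1 (lax_core s z w w' d d') ** Rmat"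
  unfolding vec_eq_iff all_2x2 Rmat_mult_nth mult_Rmat_nth leg_sum fst_conv snd_conv
  using assms by (intro conjI; elim insertE emptyE; simp add: lax_core_def; simp only: lax_normal; simp)

text \<open>The partner with superscript -s and inverted generators is the barred matrix of the same
  site. When dressed matrices at z and y meet across S, this is the pair that faces each
  other.\<close>

lemma LSL:
  assumes "s \<in> {-1, 0, 1}"
  shows "leg1 (lax_core s z w w' d d') ** Smat ** leg2 (lax_core (-s) y w' w d' d)
    = leg2 (lax_core (-s) y w' w d' d) ** Smat ** leg1 (lax_core s z w w' d d')"
  unfolding vec_eq_iff all_2x2 leg1_Smat_leg2 leg2_Smat_leg1 sum_2 Smat_nth fst_conv snd_conv
  using assms by (intro conjI; elim insertE emptyE; simp add: lax_core_def; simp only: lax_normal; simp)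

lemma LSL':
  assumes "s \<in> {-1, 0, 1}"
  shows "leg2 (lax_core s y w w' d d') ** Smat ** leg1 (lax_core (-s) z w' w d' d)
    = leg1 (lax_core (-s) z w' w d' d) ** Smat ** leg2 (lax_core s y w w' d d')"
  \<comment> \<open>Interchanging each generator with its inverse and s with -s exchanges the two
    partners.\<close>
  using lax_pair.LSL[OF swap, of "-s"] assms by auto

end

section \<open>Dressing solutions of the reflection equation\<close>

lemma leg1_mult: "leg1 (A ** B) = leg1 A ** leg1 B"
  unfolding vec_eq_iff all_2x2 by (simp add: leg1_mult_nth sum_2) (simp add: leg1_def matrix_matrix_mult_def sum_2)

lemma leg2_mult: "leg2 (A ** B) = leg2 A ** leg2 B"
  unfolding vec_eq_iff all_2x2 by (simp add: leg2_mult_nth sum_2) (simp add: leg2_def matrix_matrix_mult_def sum_2)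

lemma leg_mat_1 [simp]: "leg1 (mat 1) = mat 1" "leg2 (mat 1) = mat 1"
  unfolding vec_eq_iff all_2x2 by (simp_all add: leg1_def leg2_def mat_def)

lemma leg_commute:
  assumes "\<And>i j k l. A $ i $ j * B $ k $ l = B $ k $ l * A $ i $ j"
  shows "leg1 A ** leg2 B = leg2 B ** leg1 A"
  by (simp add: vec_eq_iff leg_sum assms)

context reflection_params begin

lemmas param_rules =
   centralD[OF central_z, of q] centralD[OF central_z, of y] centralD[OF central_y, of q]
   central_left_commute[OF central_z, of q] central_left_commute[OF central_z, of y]
   central_left_commute[OF central_y, of q]

definition reflection :: "'r ^ 2 ^ 2 \<Rightarrow> 'r ^ 2 ^ 2 \<Rightarrow> bool" where
  "reflection U V \<longleftrightarrow> Rmat ** leg1 U ** Smat ** leg2 V = leg2 V ** Smat ** leg1 U ** Rmat"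

text \<open>For the identity matrix the equation says that R and S commute; this is the start of the
  dressing.\<close>

lemma reflection_mat_1: "reflection (mat 1) (mat 1)"
  unfolding reflection_def leg_mat_1 matrix_mul_rid matrix_mul_lid vec_eq_iff all_2x2 Rmat_mult_nth mult_Rmat_nth Smat_nth
  by (simp add: mat_def; simp only: distrib_left distrib_right left_diff_distrib right_diff_distrib
      mult.assoc mult_1_left mult_1_right param_rules; simp add: algebra_simps)

text \<open>The crossed relation first frees \<open>L\<close> from the following \<open>B'\<close>;
  commutation of distinct sites then gathers the two \<open>B\<close> on the left and the two
  \<open>L\<close> on the right. Now R travels from left to right through the \<open>B\<close> pair,
  the inner solution and the \<open>L\<close> pair, and the regrouping is undone.\<close>

lemma reflection_dress:
  assumes U: "reflection U U'"
    and RLL: "Rmat ** (leg1 L ** leg2 L') = leg2 L' ** leg1 L ** Rmat"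
    and RBB: "Rmat ** (leg1 B ** leg2 B') = leg2 B' ** leg1 B ** Rmat"
    and LSB: "leg1 L ** Smat ** leg2 B' = leg2 B' ** Smat ** leg1 L"
    and LSB': "leg2 L' ** Smat ** leg1 B = leg1 B ** Smat ** leg2 L'"
    and UB: "leg1 U ** leg2 B' = leg2 B' ** leg1 U"  "leg1 B ** leg2 U' = leg2 U' ** leg1 B"
    and UL: "leg1 L ** leg2 U' = leg2 U' ** leg1 L" "leg1 U ** leg2 L' = leg2 L' ** leg1 U"
  shows "reflection (B ** U ** L) (B' ** U' ** L')"
proof -
  have "Rmat ** leg1 (B ** U ** L) ** Smat ** leg2 (B' ** U' ** L')
    = Rmat ** leg1 B ** leg1 U ** (leg1 L ** Smat ** leg2 B') ** leg2 U' ** leg2 L'"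
    by (simp add: leg1_mult leg2_mult matrix_mul_assoc)
  also have "\<dots> = Rmat ** leg1 B ** (leg1 U ** leg2 B') ** Smat ** (leg1 L ** leg2 U') ** leg2 L'"
    by (simp only: LSB) (simp only: matrix_mul_assoc)
  also have "\<dots> = (Rmat ** (leg1 B ** leg2 B')) ** leg1 U ** Smat ** leg2 U' ** leg1 L ** leg2 L'"
    by (simp only: UB UL) (simp only: matrix_mul_assoc)
  also have "\<dots> = leg2 B' ** leg1 B ** (Rmat ** leg1 U ** Smat ** leg2 U') ** leg1 L ** leg2 L'"
    by (simp only: RBB) (simp only: matrix_mul_assoc)
  also have "\<dots> = leg2 B' ** leg1 B ** leg2 U' ** Smat ** leg1 U ** (Rmat ** (leg1 L ** leg2 L'))"
    by (simp only: U[unfolded reflection_def]) (simp only: matrix_mul_assoc)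
  also have "\<dots> = leg2 B' ** (leg1 B ** leg2 U') ** Smat ** (leg1 U ** leg2 L') ** leg1 L ** Rmat"
    by (simp only: RLL) (simp only: matrix_mul_assoc)
  also have "\<dots> = leg2 B' ** leg2 U' ** (leg1 B ** Smat ** leg2 L') ** leg1 U ** leg1 L ** Rmat"
    by (simp only: UB UL) (simp only: matrix_mul_assoc)
  also have "\<dots> = leg2 (B' ** U' ** L') ** Smat ** leg1 (B ** U ** L) ** Rmat"
    by (simp only: LSB'[symmetric] leg1_mult leg2_mult matrix_mul_assoc)
  finally show ?thesis by (simp only: reflection_def)
qed

end

section \<open>Commutators of diagonal entries\<close>

lemma central_closed:
  "central 1" "central a \<Longrightarrow> central b \<Longrightarrow> central (a * b)"
  "central a \<Longrightarrow> central b \<Longrightarrow> central (a - b)"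
  unfolding central_def by (simp, metis mult.assoc, simp add: left_diff_distrib right_diff_distrib)

text \<open>
  The next two lemmas carry out the linear elimination that extracts
  \<open>A(z) D(y) - D(y) A(z) + D(z) A(y) - A(y) D(z)\<close>, here \<open>a + b\<close>, from six entries of the
  reflection equation; \<open>bb\<close> and \<open>cc\<close> are the commutators of the off-diagonal entries.
\<close>

lemma central_elimination:
  fixes s t g z y e a b bb cc m n :: "'r::ring_1"
  assumes c: "central s" "central t" "central g" "central z" "central y" "central e"
    and E36: "s * t * (a + b) + s * g * bb + s * g * (z * y) * cc + g * z * e * m + g * y * e * n = 0"
    and E5: "s * e * m + g * y * g * bb + g * y * t * a = 0"
    and E4: "s * e * n + g * z * g * (z * y) * cc + g * z * t * b = 0"
  shows "(s * s - g * g * (z * y)) * (t * (a + b) + g * bb + g * (z * y) * cc) = 0"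
proof -
  \<comment> \<open>The multipliers s, -g z and -g y are chosen so that the terms in
    \<open>m\<close> and \<open>n\<close> cancel.\<close>
  have "(s * s - g * g * (z * y)) * (t * (a + b) + g * bb + g * (z * y) * cc)
    = s * (s * t * (a + b) + s * g * bb + s * g * (z * y) * cc + g * z * e * m + g * y * e * n)
      - g * z * (s * e * m + g * y * g * bb + g * y * t * a)
      - g * y * (s * e * n + g * z * g * (z * y) * cc + g * z * t * b)"
    by (simp only: distrib_left distrib_right left_diff_distrib right_diff_distrib mult.assoc
      c(1)[THEN centralD, of t] c(1)[THEN central_left_commute, of t]
      c(1-2)[THEN centralD, of g] c(1-2)[THEN central_left_commute, of g]
      c(1-3)[THEN centralD, of z] c(1-3)[THEN central_left_commute, of z]
      c(1-4)[THEN centralD, of y] c(1-4)[THEN central_left_commute, of y]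
      c(1-5)[THEN centralD, of e] c(1-5)[THEN central_left_commute, of e]) (simp add: algebra_simps)
  then show ?thesis by (simp add: E36 E4 E5)
qed

lemma central_elimination2:
  fixes d f t g p a b bb cc :: "'r::ring_1"
  assumes c: "central d" "central f" "central t" "central g" "central p"
    and F: "f * (t * (a + b) + g * bb + g * p * cc) = 0"
    and E1: "d * (g * p * a + t * bb) = 0"
    and E2: "d * (t * cc + g * b) = 0"
  shows "d * (f * ((t * t - g * g * p) * (a + b))) = 0"
proof -
  \<comment> \<open>With multipliers d t, -f g and -f g p the terms in \<open>bb\<close> and
    \<open>cc\<close> cancel.\<close>
  have "d * (f * ((t * t - g * g * p) * (a + b)))
    = d * t * (f * (t * (a + b) + g * bb + g * p * cc))
     - f * g * (d * (g * p * a + t * bb)) - f * g * p * (d * (t * cc + g * b))"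
    by (simp only: distrib_left distrib_right left_diff_distrib right_diff_distrib mult.assoc
      c(1)[THEN centralD, of f] c(1)[THEN central_left_commute, of f]
      c(1-2)[THEN centralD, of t] c(1-2)[THEN central_left_commute, of t]
      c(1-3)[THEN centralD, of g] c(1-3)[THEN central_left_commute, of g]
      c(1-4)[THEN centralD, of p] c(1-4)[THEN central_left_commute, of p]) (simp add: algebra_simps)
  then show ?thesis by (simp add: F E1 E2)
qed

context reflection_params begin

lemma reflection_nth:
  assumes "reflection U V"
  shows "(Rmat ** (leg1 U ** Smat ** leg2 V)) $ p $ r = (leg2 V ** Smat ** leg1 U ** Rmat) $ p $ r"
  using assms unfolding reflection_def by (simp only: matrix_mul_assoc)

lemma reflection_commute:
  assumes "reflection U V"
  shows "(q * q * z - y) * ((q * q - z * y) * (U $ 1 $ 1 * V $ 1 $ 1 - V $ 1 $ 1 * U $ 1 $ 1)) = 0"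
    and "(q * q * z - y) * ((q * q - z * y) * (U $ 2 $ 2 * V $ 2 $ 2 - V $ 2 $ 2 * U $ 2 $ 2)) = 0"
    and "(q * q * z - y) * ((q * q * z - y) * ((z - q * q * y) * ((q * q - z * y) * ((1 - q * q * (z * y)) *
      (U $ 1 $ 1 * V $ 2 $ 2 - V $ 1 $ 1 * U $ 2 $ 2 + (U $ 2 $ 2 * V $ 1 $ 1 - V $ 2 $ 2 * U $ 1 $ 1)))))) = 0"
proof -
  \<comment> \<open>\<open>?a\<close> and \<open>?b\<close> are not commutators: single entries of
    the equation produce A(z) D(y) - A(y) D(z) and D(z) A(y) - D(y) A(z), and only the sum
    \<open>?a + ?b\<close> consists of the commutators of A with D.\<close>
  let ?m = "U $ 2 $ 1 * V $ 1 $ 2 - V $ 1 $ 2 * U $ 2 $ 1"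
  let ?n = "U $ 1 $ 2 * V $ 2 $ 1 - V $ 2 $ 1 * U $ 1 $ 2"
  let ?bb = "U $ 1 $ 2 * V $ 1 $ 2 - V $ 1 $ 2 * U $ 1 $ 2"
  let ?cc = "U $ 2 $ 1 * V $ 2 $ 1 - V $ 2 $ 1 * U $ 2 $ 1"
  let ?a = "U $ 1 $ 1 * V $ 2 $ 2 - V $ 1 $ 1 * U $ 2 $ 2"
  let ?b = "U $ 2 $ 2 * V $ 1 $ 1 - V $ 2 $ 2 * U $ 1 $ 1"
  define d where "d = q * q * z - y"
  define e where "e = q * q - z * y"
  define s where "s = q * (z - y)"
  define t where "t = q * (1 - z * y)"
  define g where "g = q * q - 1"
  note cs = central_closed central_q central_y central_z
  have c: "central d" "central e" "central s" "central t" "central g" "central z" "central y"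
    by (simp_all add: d_def e_def s_def t_def g_def cs)
  note E = reflection_nth[OF assms]
  note expand = distrib_left distrib_right left_diff_distrib right_diff_distrib mult.assoc
      c(1)[THEN centralD, of e] c(1)[THEN central_left_commute, of e]
      c(1-2)[THEN centralD, of s] c(1-2)[THEN central_left_commute, of s]
      c(1-3)[THEN centralD, of t] c(1-3)[THEN central_left_commute, of t]
      c(1-4)[THEN centralD, of g] c(1-4)[THEN central_left_commute, of g]
      c(1-5)[THEN centralD, of z] c(1-5)[THEN central_left_commute, of z]
      c(1-6)[THEN centralD, of y] c(1-6)[THEN central_left_commute, of y]
      c(1-7)[THEN centralD, of "U $ i $ j" for i j] c(1-7)[THEN central_left_commute, of "U $ i $ j" for i j]
      c[THEN centralD, of "V $ i $ j" for i j] c[THEN central_left_commute, of "V $ i $ j" for i j]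
  note simps = Rmat_mult_nth mult_Rmat_nth leg1_Smat_leg2 leg2_Smat_leg1 sum_2 Smat_nth fst_conv snd_conv
    d_def[symmetric] e_def[symmetric] s_def[symmetric] t_def[symmetric] g_def[symmetric]
    one_neq_two simp_thms if_True if_False mult_zero_left mult_zero_right add_0_left add_0_right
  show "d * (e * (U $ 1 $ 1 * V $ 1 $ 1 - V $ 1 $ 1 * U $ 1 $ 1)) = 0"
    using E[of "(1,1)" "(1,1)"] by (simp only: simps; simp only: expand; simp add: algebra_simps)
  show "d * (e * (U $ 2 $ 2 * V $ 2 $ 2 - V $ 2 $ 2 * U $ 2 $ 2)) = 0"
    using E[of "(2,2)" "(2,2)"] by (simp only: simps; simp only: expand; simp add: algebra_simps)
  have E1: "d * (g * (z * y) * ?a + t * ?bb) = 0"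
    using E[of "(1,1)" "(2,2)"] by (simp only: simps; simp only: expand; simp add: algebra_simps)
  have E2: "d * (t * ?cc + g * ?b) = 0"
    using E[of "(2,2)" "(1,1)"] by (simp only: simps; simp only: expand; simp add: algebra_simps)
  have E4: "s * e * ?n + g * z * g * (z * y) * ?cc + g * z * t * ?b = 0"
    using E[of "(1,2)" "(2,1)"] by (simp only: simps; simp only: expand; simp add: algebra_simps)
  have E5: "s * e * ?m + g * y * g * ?bb + g * y * t * ?a = 0"
    using E[of "(2,1)" "(1,2)"] by (simp only: simps; simp only: expand; simp add: algebra_simps)
  \<comment> \<open>In \<open>E3\<close> and \<open>E6\<close> separately the off-diagonal products
    occur in one order only; adding the two completes them to the commutators \<open>?bb\<close>,
    \<open>?cc\<close>, \<open>?m\<close> and \<open>?n\<close>.\<close>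
  have E3: "s * t * (U $ 1 $ 1 * V $ 2 $ 2 - V $ 2 $ 2 * U $ 1 $ 1) + s * g * (U $ 1 $ 2 * V $ 1 $ 2)
    + g * z * e * (U $ 2 $ 1 * V $ 1 $ 2)
    - g * y * e * (V $ 2 $ 1 * U $ 1 $ 2) - s * g * (z * y) * (V $ 2 $ 1 * U $ 2 $ 1) = 0"
    using E[of "(1,2)" "(1,2)"] by (simp only: simps; simp only: expand; simp add: algebra_simps)
  have E6: "s * t * (U $ 2 $ 2 * V $ 1 $ 1 - V $ 1 $ 1 * U $ 2 $ 2) - s * g * (V $ 1 $ 2 * U $ 1 $ 2)
    - g * z * e * (V $ 1 $ 2 * U $ 2 $ 1) + g * y * e * (U $ 1 $ 2 * V $ 2 $ 1)
    + s * g * (z * y) * (U $ 2 $ 1 * V $ 2 $ 1) = 0"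
    using E[of "(2,1)" "(2,1)"] by (simp only: simps; simp only: expand; simp add: algebra_simps)
  have "s * t * (?a + ?b) + s * g * ?bb + s * g * (z * y) * ?cc + g * z * e * ?m + g * y * e * ?n = 0"
    using arg_cong2[OF E3 E6, of "(+)"] by (simp add: algebra_simps)
  from central_elimination[OF c(3,4,5,6,7,2) this E5 E4]
  have "(s * s - g * g * (z * y)) * (t * (?a + ?b) + g * ?bb + g * (z * y) * ?cc) = 0" .
  from central_elimination2[OF _ _ _ _ _ this E1 E2] c
  have "d * ((s * s - g * g * (z * y)) * ((t * t - g * g * (z * y)) * (?a + ?b))) = 0"
    by (simp add: central_closed)
  \<comment> \<open>This factorisation and the next one express the prefactor through binomials,
    which can be cancelled later.\<close>
  also have "s * s - g * g * (z * y) = (q * q * z - y) * (z - q * q * y)" unfolding s_def g_def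
    by (simp only: distrib_left distrib_right left_diff_distrib right_diff_distrib
      mult.assoc mult_1_left mult_1_right param_rules; simp add: algebra_simps)
  also have "t * t - g * g * (z * y) = (q * q - z * y) * (1 - q * q * (z * y))" unfolding t_def g_def
    by (simp only: distrib_left distrib_right left_diff_distrib right_diff_distrib
      mult.assoc mult_1_left mult_1_right param_rules; simp add: algebra_simps)
  finally show "d * ((q * q * z - y) * ((z - q * q * y) * (e * ((1 - q * q * (z * y)) * (?a + ?b))))) = 0"
    unfolding e_def by (simp only: mult.assoc)
qed

end

section \<open>Laurent polynomials in two variables\<close>

lemma poly_mapping_single_add_induct [case_names zero single_add]:
  fixes p :: "'m \<Rightarrow>\<^sub>0 'a::ab_group_add"
  assumes "P 0" "\<And>m c p. P p \<Longrightarrow> P (Poly_Mapping.single m c + p)"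
  shows "P p"
proof -
  have "P g" if "Poly_Mapping.keys g \<subseteq> S" "finite S" for S g
    using that(2,1)
  proof (induction S arbitrary: g rule: finite_induct)
    case empty
    then show ?case using assms(1) by simp
  next
    case (insert u S)
    let ?s = "Poly_Mapping.single u (Poly_Mapping.lookup g u)"
    have "Poly_Mapping.keys (g - ?s) \<subseteq> S"
      using insert.prems by (auto simp: in_keys_iff lookup_minus lookup_single when_def split: if_splits)
    then have "P (?s + (g - ?s))" by (intro assms(2) insert.IH)
    then show ?case by simp
  qed
  then show ?thesis using finite_keys by blast
qed

lemma central_single:
  fixes c :: "'a::ring_1" and m :: "'m::comm_monoid_add"
  assumes "central c" shows "central (Poly_Mapping.single m c)"
  unfolding central_def
proof
  fix p :: "'m \<Rightarrow>\<^sub>0 'a"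
  show "Poly_Mapping.single m c * p = p * Poly_Mapping.single m c"
    by (induction p rule: poly_mapping_single_add_induct)
      (simp_all add: distrib_left distrib_right mult_single add.commute centralD[OF assms])
qed

lemma central_single_1: "central (Poly_Mapping.single (m :: 'm::comm_monoid_add) (1 :: 'a::ring_1))"
  by (intro central_single central_closed)

lemma lookup_single_mult:
  fixes m :: "'m::ab_group_add" and c :: "'a::ring_1"
  shows "Poly_Mapping.lookup (Poly_Mapping.single m c * p) k = c * Poly_Mapping.lookup p (k - m)"
  by (induction p rule: poly_mapping_single_add_induct)
     (auto simp: distrib_left mult_single lookup_add lookup_single when_def algebra_simps)

text \<open>Since \<open>c\<close> and \<open>e\<close> are left invertible, vanishing of the
  product makes the support of \<open>p\<close> stable under translation by a - b and by b - a. The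
  additive height \<open>h\<close> differs at \<open>a\<close> and \<open>b\<close>, so one
  translation raises the height of a highest exponent, which a finite nonempty support forbids. The
  coefficient ring itself may have zero divisors.\<close>

lemma binomial_mult_eq_0_imp_eq_0:
  fixes p :: "'m::ab_group_add \<Rightarrow>\<^sub>0 'a::ring_1" and h :: "'m \<Rightarrow> int"
  assumes 0: "(Poly_Mapping.single a c - Poly_Mapping.single b e) * p = 0"
    and h: "\<And>x y. h (x - y) = h x - h y" "h a \<noteq> h b"
    and inv: "c' * c = 1" "e' * e = 1"
  shows "p = 0"
proof (rule ccontr)
  assume "p \<noteq> 0"
  let ?K = "Poly_Mapping.keys p"
  have K: "finite ?K" "?K \<noteq> {}" using \<open>p \<noteq> 0\<close> by auto
  have eq: "c * Poly_Mapping.lookup p (k - a) = e * Poly_Mapping.lookup p (k - b)" for k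
    using arg_cong[OF 0, of "\<lambda>f. Poly_Mapping.lookup f k"]
    by (simp add: left_diff_distrib lookup_minus lookup_single_mult)
  have h_add: "h (x + y) = h x + h y" for x y
    using h(1)[of "x + y" y] by simp
  have unit: "u' * u = 1 \<Longrightarrow> u * x = 0 \<Longrightarrow> x = 0" for u u' x :: 'a
    by (metis mult.assoc mult_1 mult_zero_right)
  have shift: "m - b + a \<in> ?K \<and> m - a + b \<in> ?K" if "m \<in> ?K" for m
  proof -
    have "e * Poly_Mapping.lookup p (m - b + a) = c * Poly_Mapping.lookup p m"
      and "c * Poly_Mapping.lookup p (m - a + b) = e * Poly_Mapping.lookup p m"
      using eq[of "m + a"] eq[of "m + b"] by (simp_all add: algebra_simps)
    then show ?thesis
      using that unit[OF inv(1)] unit[OF inv(2)] by (metis in_keys_iff mult_zero_right)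
  qed
  obtain m where m: "m \<in> ?K" "\<And>k. k \<in> ?K \<Longrightarrow> h k \<le> h m"
    using Max_in[of "h ` ?K"] Max_ge[of "h ` ?K"] K by fastforce
  from m(2)[OF conjunct1[OF shift[OF m(1)]]] m(2)[OF conjunct2[OF shift[OF m(1)]]] h(2)
  show False by (simp add: h_add h(1))
qed

text \<open>
  With \<open>f m = (m, 0)\<close> and \<open>f m = (0, m)\<close> this embeds Laurent polynomials in one variable into those in
  two variables; commutativity of the coefficients is read off there.
\<close>

definition reindex :: "('m \<Rightarrow> 'l) \<Rightarrow> ('m \<Rightarrow>\<^sub>0 'a::ring_1) \<Rightarrow> ('l \<Rightarrow>\<^sub>0 'a)" where
  "reindex f p = (\<Sum>m\<in>Poly_Mapping.keys p. Poly_Mapping.single (f m) (Poly_Mapping.lookup p m))"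

lemma reindex_superset:
  assumes "finite S" "Poly_Mapping.keys p \<subseteq> S"
  shows "reindex f p = (\<Sum>m\<in>S. Poly_Mapping.single (f m) (Poly_Mapping.lookup p m))"
  unfolding reindex_def
  by (rule sum.mono_neutral_left) (use assms in \<open>auto simp: in_keys_iff\<close>)

lemma reindex_0 [simp]: "reindex f 0 = 0"
  by (simp add: reindex_def)

lemma reindex_single [simp]: "reindex f (Poly_Mapping.single m c) = Poly_Mapping.single (f m) c"
  by (simp add: reindex_def)

lemma reindex_add: "reindex f (p + q) = reindex f p + reindex f q"
proof -
  let ?S = "Poly_Mapping.keys p \<union> Poly_Mapping.keys q"
  have "reindex f (p + q)
      = (\<Sum>m\<in>?S. Poly_Mapping.single (f m) (Poly_Mapping.lookup (p + q) m))"
    by (rule reindex_superset) (auto simp: Poly_Mapping.keys_add)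
  then show ?thesis
    by (simp add: reindex_superset[of ?S] lookup_add single_add sum.distrib)
qed

lemma reindex_mult:
  fixes f :: "'m::monoid_add \<Rightarrow> 'l::monoid_add"
  assumes "\<And>x y. f (x + y) = f x + f y"
  shows "reindex f (p * q) = reindex f p * reindex f q"
proof (induction p rule: poly_mapping_single_add_induct)
  case (single_add m c p)
  have "reindex f (Poly_Mapping.single m c * q) = Poly_Mapping.single (f m) c * reindex f q"
    by (induction q rule: poly_mapping_single_add_induct)
      (simp_all add: distrib_left mult_single reindex_add assms)
  then show ?case using single_add by (simp add: distrib_right reindex_add)
qed simp

lemma reindex_diff: "reindex f (p - q) = reindex f p - reindex f q"
  using reindex_add[of f "p - q" q] by (simp add: algebra_simps)

lemma reindex_minus: "reindex f (- q) = - reindex f q"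
  using reindex_diff[of f 0 q] by simp

text \<open>An exponent pair (a, b) splits in exactly one way into a part on each axis. Equality of
  the two products in two variables therefore means that all coefficients of p and q
  commute.\<close>

lemma lookup_reindex_mult:
  fixes p q :: "int \<Rightarrow>\<^sub>0 'a::ring_1"
  shows "Poly_Mapping.lookup (reindex (\<lambda>m. (m, 0 :: int)) p * reindex (Pair (0 :: int)) q) (a, b)
      = Poly_Mapping.lookup p a * Poly_Mapping.lookup q b"
    and "Poly_Mapping.lookup (reindex (Pair (0 :: int)) q * reindex (\<lambda>m. (m, 0 :: int)) p) (a, b)
      = Poly_Mapping.lookup q b * Poly_Mapping.lookup p a"
proof -
  have 1: "Poly_Mapping.lookup (reindex (Pair (0 :: int)) q) (x, b)
    = (if x = 0 then Poly_Mapping.lookup q b else 0)" for x :: int and b and q :: "int \<Rightarrow>\<^sub>0 'a"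
    by (induction q rule: poly_mapping_single_add_induct)
      (auto simp: reindex_add lookup_add lookup_single when_def)
  have 2: "Poly_Mapping.lookup (reindex (\<lambda>m. (m, 0 :: int)) q) (b, x)
    = (if x = 0 then Poly_Mapping.lookup q b else 0)" for x :: int and b and q :: "int \<Rightarrow>\<^sub>0 'a"
    by (induction q rule: poly_mapping_single_add_induct)
      (auto simp: reindex_add lookup_add lookup_single when_def)
  show "Poly_Mapping.lookup (reindex (\<lambda>m. (m, 0 :: int)) p * reindex (Pair (0 :: int)) q) (a, b)
      = Poly_Mapping.lookup p a * Poly_Mapping.lookup q b"
    by (induction p rule: poly_mapping_single_add_induct)
      (simp_all add: reindex_add lookup_add distrib_right lookup_single_mult 1 lookup_single when_def)
  show "Poly_Mapping.lookup (reindex (Pair (0 :: int)) q * reindex (\<lambda>m. (m, 0 :: int)) p) (a, b)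
      = Poly_Mapping.lookup q b * Poly_Mapping.lookup p a"
    by (induction q rule: poly_mapping_single_add_induct)
      (simp_all add: reindex_add lookup_add distrib_right lookup_single_mult 2 lookup_single when_def)
qed

section \<open>Nested products over commuting sites\<close>

fun sandwich :: "(nat \<Rightarrow> 'r::ring_1 ^ 2 ^ 2) \<Rightarrow> (nat \<Rightarrow> 'r ^ 2 ^ 2) \<Rightarrow> nat list \<Rightarrow> 'r ^ 2 ^ 2" where
  "sandwich B L [] = mat 1"
| "sandwich B L (i # is) = B i ** sandwich B L is ** L i"

definition map_mat2 :: "('r \<Rightarrow> 's) \<Rightarrow> 'r ^ 2 ^ 2 \<Rightarrow> 's ^ 2 ^ 2" where
  "map_mat2 h A = (\<chi> i j. h (A $ i $ j))"

lemma map_mat2_mat2: "map_mat2 h (mat2 a b c d) = mat2 (h a) (h b) (h c) (h d)"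
  by (simp add: map_mat2_def vec_eq_iff forall_2)

lemma map_mat2_sandwich:
  fixes h :: "'r::ring_1 \<Rightarrow> 's::ring_1"
  assumes h: "\<And>x y. h (x * y) = h x * h y" "\<And>x y. h (x + y) = h x + h y" "h 0 = 0" "h 1 = 1"
  shows "map_mat2 h (sandwich B L is) = sandwich (\<lambda>i. map_mat2 h (B i)) (\<lambda>i. map_mat2 h (L i)) is"
proof (induction "is")
  case Nil
  show ?case by (simp add: map_mat2_def mat_def vec_eq_iff h)
next
  case (Cons i "is")
  have "map_mat2 h (A ** B) = map_mat2 h A ** map_mat2 h B" for A B
    by (simp add: map_mat2_def matrix_matrix_mult_def vec_eq_iff sum_2 h)
  then show ?case by (simp add: Cons.IH)
qed

lemma commute_mult: "a * x = x * a \<Longrightarrow> a * y = y * a \<Longrightarrow> a * (x * y) = (x * y) * (a :: 'r::semigroup_mult)"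
  by (metis mult.assoc)

lemma commute_mult_nth:
  fixes A B :: "'r::ring_1 ^ 2 ^ 2"
  assumes "\<And>i j. a * A $ i $ j = A $ i $ j * a" "\<And>i j. a * B $ i $ j = B $ i $ j * a"
  shows "a * (A ** B) $ i $ j = (A ** B) $ i $ j * a"
  by (simp add: matrix_matrix_mult_def sum_2 distrib_left distrib_right commute_mult[OF assms])

lemma commute_sandwich_nth:
  assumes "\<And>l i j. l \<in> set is \<Longrightarrow> a * B l $ i $ j = B l $ i $ j * a"
    and "\<And>l i j. l \<in> set is \<Longrightarrow> a * L l $ i $ j = L l $ i $ j * a"
  shows "a * sandwich B L is $ i $ j = sandwich B L is $ i $ j * a"
  using assms
proof (induction "is" arbitrary: i j)
  case Nil
  show ?case by (simp add: mat_def)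
next
  case (Cons l "is")
  have "a * sandwich B L is $ i $ j = sandwich B L is $ i $ j * a" for i j
    by (rule Cons.IH) (use Cons.prems in auto)
  then show ?case
    unfolding sandwich.simps by (intro commute_mult_nth) (use Cons.prems in auto)
qed

lemma commute_lax_core_nth:
  assumes "central z" "a * w = w * a" "a * w' = w' * a" "a * d = d * a" "a * d' = d' * a"
  shows "a * lax_core s z w w' d d' $ i $ j = lax_core s z w w' d d' $ i $ j * a"
proof -
  have z: "a * z = z * a" using assms(1) by (rule centralD)
  show ?thesis
    using exhaust_2[of i] exhaust_2[of j]
    by (elim disjE) (simp_all add: lax_core_def left_diff_distrib right_diff_distrib commute_mult assms(2-) z)
qed

text \<open>Stated over an arbitrary ring so that it can be instantiated in A_n itself and in
  Laurent polynomials over A_n in one and in two variables.\<close>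

locale weyl_family =
  fixes q q' :: "'r::ring_1" and w w' d d' :: "nat \<Rightarrow> 'r" and I :: "nat set"
  assumes pair: "i \<in> I \<Longrightarrow> weyl_pair q q' (w i) (w' i) (d i) (d' i)"
    and commute: "i \<in> I \<Longrightarrow> j \<in> I \<Longrightarrow> i \<noteq> j \<Longrightarrow> a \<in> {w i, w' i, d i, d' i} \<Longrightarrow>
      b \<in> {w j, w' j, d j, d' j} \<Longrightarrow> a * b = b * a"
begin

definition monodromy_core :: "(nat \<Rightarrow> int) \<Rightarrow> 'r \<Rightarrow> nat list \<Rightarrow> 'r ^ 2 ^ 2" where
  "monodromy_core k z = sandwich (\<lambda>i. lax_core (- k i) z (w' i) (w i) (d' i) (d i))
     (\<lambda>i. lax_core (k i) z (w i) (w' i) (d i) (d' i))"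

lemma lax_core_commute:
  assumes "central z" "central y" "i \<in> I" "j \<in> I" "i \<noteq> j"
    and X: "X \<in> {lax_core s z (w i) (w' i) (d i) (d' i), lax_core s z (w' i) (w i) (d' i) (d i)}"
    and Y: "Y \<in> {lax_core r y (w j) (w' j) (d j) (d' j), lax_core r y (w' j) (w j) (d' j) (d j)}"
  shows "X $ a $ b * Y $ c $ e = Y $ c $ e * X $ a $ b"
proof -
  have 1: "u * X $ a $ b = X $ a $ b * u" if "u \<in> {w j, w' j, d j, d' j}" for u
    using X that commute[OF assms(4,3)] assms(5)
    by (auto intro!: commute_lax_core_nth assms simp del: insert_iff)
  show ?thesis
    using Y 1 by (auto intro!: commute_lax_core_nth assms simp: 1[symmetric])
qed

text \<open>Each recursion step of \<open>sandwich\<close> is one dressing. Distinctness of the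
  sites makes the entries of the new outer matrices commute with the inner monodromy.\<close>

lemma reflection_monodromy_core:
  assumes "central z" "central y" "\<And>i. i \<in> I \<Longrightarrow> k i \<in> {-1, 0, 1}"
    and "set is \<subseteq> I" "distinct is" "central q"
  shows "reflection_params.reflection q z y (monodromy_core k z is) (monodromy_core k y is)"
proof -
  interpret reflection_params q z y
    by unfold_locales (use assms in auto)
  show ?thesis
    using assms(4,5)
  proof (induction "is")
    case Nil
    then show ?case by (simp add: monodromy_core_def reflection_mat_1)
  next
    case (Cons i "is")
    then have i: "i \<in> I" "i \<notin> set is" by auto
    interpret lax_pair q q' z y "w i" "w' i" "d i" "d' i"
      by (intro lax_pair.intro pair i reflection_params_axioms)
    interpret sw: lax_pair q q' z y "w' i" "w i" "d' i" "d i"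
      by (rule swap)
    have k: "k i \<in> {-1, 0, 1}" "- k i \<in> {-1, 0, 1}" using assms(3)[OF i(1)] by auto
    have comm: "X $ a $ b * monodromy_core k y' is $ c $ e = monodromy_core k y' is $ c $ e * X $ a $ b"
      if X: "X = lax_core (k i) z' (w i) (w' i) (d i) (d' i) \<or> X = lax_core (- k i) z' (w' i) (w i) (d' i) (d i)"
        and z': "z' = z \<or> z' = y" "y' = z \<or> y' = y" for X z' y' a b c e
      unfolding monodromy_core_def
    proof (rule commute_sandwich_nth)
      fix l m n assume "l \<in> set is"
      then have l: "l \<in> I" "i \<noteq> l" using Cons.prems i by auto
      show "X $ a $ b * lax_core (- k l) y' (w' l) (w l) (d' l) (d l) $ m $ n
          = lax_core (- k l) y' (w' l) (w l) (d' l) (d l) $ m $ n * X $ a $ b"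
        using X z' assms(1,2)
        by (elim disjE) (auto intro: lax_core_commute[OF _ _ i(1) l, where r = "- k l"])
      show "X $ a $ b * lax_core (k l) y' (w l) (w' l) (d l) (d' l) $ m $ n
          = lax_core (k l) y' (w l) (w' l) (d l) (d' l) $ m $ n * X $ a $ b"
        using X z' assms(1,2)
        by (elim disjE) (auto intro: lax_core_commute[OF _ _ i(1) l, where r = "k l"])
    qed
    show ?case
      unfolding monodromy_core_def sandwich.simps
      unfolding monodromy_core_def[symmetric]
    proof (rule reflection_dress[OF _ RLL[OF k(1)] sw.RLL[OF k(2)] LSL[OF k(1)] LSL'[OF k(1)]])
      show "reflection (monodromy_core k z is) (monodromy_core k y is)"
        using Cons by simp
      show "leg1 (monodromy_core k z is) ** leg2 (lax_core (- k i) y (w' i) (w i) (d' i) (d i)) = leg2 (lax_core (- k i) y (w' i) (w i) (d' i) (d i)) ** leg1 (monodromy_core k z is)"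
        by (rule leg_commute, rule comm[symmetric]) auto
      show "leg1 (lax_core (- k i) z (w' i) (w i) (d' i) (d i)) ** leg2 (monodromy_core k y is) = leg2 (monodromy_core k y is) ** leg1 (lax_core (- k i) z (w' i) (w i) (d' i) (d i))"
        by (rule leg_commute, rule comm) auto
      show "leg1 (lax_core (k i) z (w i) (w' i) (d i) (d' i)) ** leg2 (monodromy_core k y is) = leg2 (monodromy_core k y is) ** leg1 (lax_core (k i) z (w i) (w' i) (d i) (d' i))"
        by (rule leg_commute, rule comm) auto
      show "leg1 (monodromy_core k z is) ** leg2 (lax_core (k i) y (w i) (w' i) (d i) (d' i)) = leg2 (lax_core (k i) y (w i) (w' i) (d i) (d' i)) ** leg1 (monodromy_core k z is)"
        by (rule leg_commute, rule comm[symmetric]) auto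
    qed
  qed
qed

end

section \<open>Commutativity of the coefficients\<close>

lemma scal_mult: "scal (a * b) = scal a * (scal b :: ('n::finite, 'N::finite) qalg)"
  by transfer (simp add: fscal_def mult_single qrel.refl)

lemma scal_1: "scal 1 = (1 :: ('n::finite, 'N::finite) qalg)"
  by transfer (simp add: fscal_def qrel.refl)

lemma scal_0: "scal 0 = (0 :: ('n::finite, 'N::finite) qalg)"
  by transfer (simp add: fscal_def qrel.refl)

lemma scal_minus: "scal (- a) = - (scal a :: ('n::finite, 'N::finite) qalg)"
  by transfer (simp add: fscal_def single_uminus qrel.refl)

lemma central_scal: "central (scal c :: ('n::finite, 'N::finite) qalg)"
proof -
  have "fscal c * x = x * fscal c" for x :: "'n falg"
    by (induction x rule: falg_induct)
      (simp_all add: fscal_def distrib_left distrib_right mult_single mult.commute)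
  then have "scal c * x = x * scal c" for x :: "('n, 'N) qalg"
    by transfer (simp add: qrel.refl)
  then show ?thesis by (simp add: central_def)
qed

lemma commute_inverse:
  fixes a :: "'r::ring_1"
  assumes "a * b = b * a" "a * a' = 1" "a' * a = 1"
  shows "a' * b = b * a'"
proof -
  have "a' * b = a' * (b * a) * a'" by (simp add: mult.assoc assms(2))
  also have "\<dots> = b * a'" by (simp add: assms(1)[symmetric] mult.assoc[symmetric] assms(3))
  finally show ?thesis .
qed

text \<open>Commutation with an invertible element passes to its inverse, so the relations among the
  uninverted generators of distinct sites suffice.\<close>

lemma weyl_familyI:
  fixes q q' :: "'r::ring_1"
  assumes pair: "\<And>i. i \<in> I \<Longrightarrow> weyl_pair q q' (w i) (w' i) (d i) (d' i)"
    and comm: "\<And>i j. i \<in> I \<Longrightarrow> j \<in> I \<Longrightarrow> i \<noteq> j \<Longrightarrow> w i * w j = w j * w i \<and> d i * d j = d j * d i \<and> d i * w j = w j * d i"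
  shows "weyl_family q q' w w' d d' I"
proof (rule weyl_family.intro)
  fix i j a b
  assume ij: "i \<in> I" "j \<in> I" "i \<noteq> j" and a: "a \<in> {w i, w' i, d i, d' i}" and b: "b \<in> {w j, w' j, d j, d' j}"
  note inv = weyl_pair.inv[OF pair[OF ij(1)]] weyl_pair.inv[OF pair[OF ij(2)]]
  have 1: "a * b = b * a" if "b \<in> {w j, d j}" for b
    using that a comm[OF ij] comm[OF ij(2,1) ij(3)[symmetric]] inv
      commute_inverse[of "w i" b "w' i"] commute_inverse[of "d i" b "d' i"] by auto
  show "a * b = b * a"
    using b 1[of "w j"] 1[of "d j"] inv
     commute_inverse[of "w j" a "w' j"] commute_inverse[of "d j" a "d' j"] by auto
qed (rule pair)

text \<open>Constants of a Laurent polynomial ring inherit the relations, whatever the number of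
  variables.\<close>

lemma weyl_family_single:
  fixes q :: "'r::ring_1"
  assumes "weyl_family q q' w w' d d' I"
  shows "weyl_family (Poly_Mapping.single (0 :: 'm::comm_monoid_add) q) (Poly_Mapping.single 0 q')
    (\<lambda>i. Poly_Mapping.single 0 (w i)) (\<lambda>i. Poly_Mapping.single 0 (w' i))
    (\<lambda>i. Poly_Mapping.single 0 (d i)) (\<lambda>i. Poly_Mapping.single 0 (d' i)) I"
proof -
  interpret weyl_family q q' w w' d d' I by fact
  show ?thesis
  proof (rule weyl_family.intro)
    fix i assume "i \<in> I"
    then interpret weyl_pair q q' "w i" "w' i" "d i" "d' i" by (rule pair)
    show "weyl_pair (Poly_Mapping.single (0 :: 'm) q) (Poly_Mapping.single 0 q')
      (Poly_Mapping.single 0 (w i)) (Poly_Mapping.single 0 (w' i))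
      (Poly_Mapping.single 0 (d i)) (Poly_Mapping.single 0 (d' i))"
      by unfold_locales (simp_all add: central_single q inv dw mult_single)
  qed (use commute in \<open>auto simp: mult_single\<close>)
qed

lemma gen_elt_commute:
  "gen_elt (GW i) * gen_elt (GW j) = gen_elt (GW j) * (gen_elt (GW i) :: ('n::finite, 'N::finite) qalg)"
  "gen_elt (GD i) * gen_elt (GD j) = gen_elt (GD j) * (gen_elt (GD i) :: ('n, 'N) qalg)"
  "gen_elt (GD i) * gen_elt (GW j) =
    scal (vv TYPE('N) ^ (if i = j then 1 else 0)) * gen_elt (GW j) * (gen_elt (GD i) :: ('n, 'N) qalg)"
  by (transfer, rule qrel.intros)+

lemma gen_elt_inverse:
  "gen_elt (GW i) * gen_elt (GWinv i) = (1 :: ('n::finite, 'N::finite) qalg)"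
  "gen_elt (GWinv i) * gen_elt (GW i) = (1 :: ('n, 'N) qalg)"
  "gen_elt (GD i) * gen_elt (GDinv i) = (1 :: ('n, 'N) qalg)"
  "gen_elt (GDinv i) * gen_elt (GD i) = (1 :: ('n, 'N) qalg)"
  by (transfer, rule qrel.intros)+

lemma pow_simps:
  "w_pow i 1 = gen_elt (GW (Abs_idx i))" "w_pow i (-1) = gen_elt (GWinv (Abs_idx i))"
  "D_pow i 1 = gen_elt (GD (Abs_idx i))" "D_pow i (-1) = gen_elt (GDinv (Abs_idx i))"
  by (simp_all add: w_pow_def D_pow_def)

lemma Abs_idx_eq_iff:
  "i \<in> {1..CARD('n)} \<Longrightarrow> j \<in> {1..CARD('n)} \<Longrightarrow> (Abs_idx i :: 'n::finite idx) = Abs_idx j \<longleftrightarrow> i = j"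
  by (rule Abs_idx_inject)

lemma weyl_family_qalg:
  "weyl_family (scal (vv TYPE('N))) (scal (inverse (vv TYPE('N))))
    (\<lambda>i. w_pow i 1 :: ('n::finite, 'N::finite) qalg) (\<lambda>i. w_pow i (-1)) (\<lambda>i. D_pow i 1) (\<lambda>i. D_pow i (-1))
    {1..CARD('n)}"
proof (rule weyl_familyI)
  fix i show "weyl_pair (scal (vv TYPE('N))) (scal (inverse (vv TYPE('N))))
    (w_pow i 1 :: ('n, 'N) qalg) (w_pow i (-1)) (D_pow i 1) (D_pow i (-1))"
    by unfold_locales (simp_all add: pow_simps gen_elt_inverse gen_elt_commute(3) central_scal
        vv_nonzero scal_1 mult.assoc flip: scal_mult)
qed (auto simp: pow_simps gen_elt_commute Abs_idx_eq_iff scal_1)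

section \<open>The monodromy matrix without half-integral powers\<close>

lemma foldr_matrix_mult_append:
  fixes xs :: "('r::ring_1 ^ 2 ^ 2) list"
  shows "foldr (**) (xs @ ys) (mat 1) = foldr (**) xs (mat 1) ** foldr (**) ys (mat 1)"
  by (induction xs) (simp_all add: matrix_mul_assoc)

lemma foldr_eq_sandwich:
  "foldr (**) (map B is @ map L (rev is)) (mat 1) = sandwich B L is"
proof (induction "is")
  case (Cons i "is")
  have "foldr (**) (map B (i # is) @ map L (rev (i # is))) (mat 1)
      = B i ** foldr (**) ((map B is @ map L (rev is)) @ [L i]) (mat 1)" by simp
  then show ?case
    by (simp only: foldr_matrix_mult_append[of _ "[L i]"] Cons.IH) (simp add: matrix_mul_assoc)
qed simp

lemma map_mat2_scale_mult:
  fixes A B :: "'r::ring_1 ^ 2 ^ 2"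
  assumes "central b"
  shows "map_mat2 ((*) a) A ** map_mat2 ((*) b) B = map_mat2 ((*) (a * b)) (A ** B)"
  by (simp add: map_mat2_def matrix_matrix_mult_def vec_eq_iff sum_2 central_left_commute[OF assms]
     distrib_left mult.assoc)

lemma sandwich_scale:
  fixes B L :: "nat \<Rightarrow> 'r::ring_1 ^ 2 ^ 2"
  assumes "\<And>i. i \<in> set is \<Longrightarrow> B i = map_mat2 ((*) (b i)) (B' i)"
    and "\<And>i. i \<in> set is \<Longrightarrow> L i = map_mat2 ((*) (l i)) (L' i)"
    and "\<And>i. i \<in> set is \<Longrightarrow> b i * l i = c" "\<And>i. central (b i)" "\<And>i. central (l i)" "central c"
  shows "sandwich B L is = map_mat2 ((*) (c ^ length is)) (sandwich B' L' is)"
  using assms(1-3)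
proof (induction "is")
  case Nil
  show ?case by (simp add: map_mat2_def vec_eq_iff)
next
  case (Cons i "is")
  have c: "central (c ^ m)" for m
    by (induction m) (use assms(6) in \<open>auto intro: central_closed\<close>)
  have "sandwich B L (i # is) = map_mat2 ((*) (b i * c ^ length is * l i)) (sandwich B' L' (i # is))"
    using Cons by (simp add: map_mat2_scale_mult c assms)
  also have "b i * c ^ length is * l i = c ^ length (i # is)"
    using Cons.prems(3)[of i] by (simp add: mult.assoc centralD[OF c])
  finally show ?case .
qed

definition lax_monodromy :: "(nat \<Rightarrow> int) \<Rightarrow> nat list \<Rightarrow> ('n::finite, 'N::finite) zpoly ^ 2 ^ 2" where
  "lax_monodromy k = weyl_family.monodromy_core (\<lambda>i. zmon (w_pow i 1) 0) (\<lambda>i. zmon (w_pow i (-1)) 0)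
     (\<lambda>i. zmon (D_pow i 1) 0) (\<lambda>i. zmon (D_pow i (-1)) 0) k (zmon 1 2)"

lemmas weyl_family_zpoly = weyl_family_single[OF weyl_family_qalg]

lemma lax_monodromy_eq: "lax_monodromy k =
  sandwich (\<lambda>i. lax_core (- k i) (zmon 1 2) (zmon (w_pow i (-1)) 0) (zmon (w_pow i 1) 0) (zmon (D_pow i (-1)) 0) (zmon (D_pow i 1) 0))
     (\<lambda>i. lax_core (k i) (zmon 1 2) (zmon (w_pow i 1) 0) (zmon (w_pow i (-1)) 0) (zmon (D_pow i 1) 0) (zmon (D_pow i (-1)) 0))"
  unfolding lax_monodromy_def weyl_family.monodromy_core_def[OF weyl_family_zpoly] ..

lemma Lax_eq_core: "s \<in> {-1, 0, 1} \<Longrightarrow> Lax i s = map_mat2 ((*) (zmon 1 (s - 1)))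
  (lax_core s (zmon 1 2) (zmon (w_pow i 1) 0) (zmon (w_pow i (-1)) 0) (zmon (D_pow i 1) 0) (zmon (D_pow i (-1)) 0))"
  by (auto simp: Lax_def lax_core_def map_mat2_mat2 mult_single right_diff_distrib)

lemma Lax_bar_eq_core: "s \<in> {-1, 0, 1} \<Longrightarrow> Lax_bar i s = map_mat2 ((*) (zmon 1 (s - 1)))
  (lax_core s (zmon 1 2) (zmon (w_pow i (-1)) 0) (zmon (w_pow i 1) 0) (zmon (D_pow i (-1)) 0) (zmon (D_pow i 1) 0))"
  by (auto simp: Lax_bar_def lax_core_def map_mat2_mat2 mult_single right_diff_distrib)

text \<open>The prefactors of the barred and the unbarred matrix of site i are z^((-k_i-1)/2) and
  z^((k_i-1)/2). Their product is z^(-1) for every k_i, so half-integral powers cancel and z^(-n)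
  remains.\<close>

lemma monodromy_eq:
  fixes k :: "nat \<Rightarrow> int"
  assumes "\<forall>i\<in>{1..CARD('n)}. k i \<in> {-1, 0, 1}"
  shows "(monodromy k :: ('n::finite, 'N::finite) zpoly ^ 2 ^ 2) =
    map_mat2 ((*) (zmon 1 (- 2 * int CARD('n)))) (lax_monodromy k [1..<Suc CARD('n)])"
proof -
  have pow: "zmon 1 (-2) ^ m = (zmon 1 (- 2 * int m) :: ('n, 'N) zpoly)" for m
    by (induction m) (simp_all add: mult_single)
  have k: "k i \<in> {-1, 0, 1}" "- k i \<in> {-1, 0, 1}" if "i \<in> {1..CARD('n)}" for i
    using that assms by auto
  show ?thesis
    unfolding monodromy_def Let_def foldr_eq_sandwich lax_monodromy_eq
    by (subst sandwich_scale[where c = "zmon 1 (-2)" and b = "\<lambda>i. zmon 1 (- k i - 1)" and l = "\<lambda>i. zmon 1 (k i - 1)"])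
      (auto simp del: One_nat_def upt_Suc simp: pow mult_single
        intro!: Lax_eq_core[OF k(1)] Lax_bar_eq_core[OF k(2)] central_single_1)
qed

definition core_comb :: "(nat \<Rightarrow> int) \<Rightarrow> ratfun \<Rightarrow> ('n::finite, 'N::finite) zpoly" where
  "core_comb k \<epsilon> = lax_monodromy k [1..<Suc CARD('n)] $ 1 $ 1
     + zmon (scal \<epsilon>) 0 * lax_monodromy k [1..<Suc CARD('n)] $ 2 $ 2"

lemma T_comb_eq:
  fixes k :: "nat \<Rightarrow> int"
  assumes "\<forall>i\<in>{1..CARD('n)}. k i \<in> {-1, 0, 1}"
  shows "(T_comb k \<epsilon> :: ('n::finite, 'N::finite) zpoly) = zmon 1 (- 2 * int CARD('n)) * core_comb k \<epsilon>"
  unfolding T_comb_def core_comb_def monodromy_eq[OF assms]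
  by (simp add: map_mat2_def distrib_left central_left_commute[OF central_single_1])

text \<open>The coefficients are 1 and v^2 up to sign, both invertible, and the exponent of z, read
  off by \<open>fst\<close>, serves as the height separating the two monomials.\<close>

lemma binomial_mult_eq_0D:
  fixes X :: "int \<times> int \<Rightarrow>\<^sub>0 ('n::finite, 'N::finite) qalg"
  defines "q \<equiv> Poly_Mapping.single 0 (scal (vv TYPE('N)))"
    and "z \<equiv> Poly_Mapping.single (2, 0) 1" and "y \<equiv> Poly_Mapping.single (0, 2) 1"
  shows "(q * q * z - y) * X = 0 \<Longrightarrow> X = 0"
    and "(z - q * q * y) * X = 0 \<Longrightarrow> X = 0"
    and "(q * q - z * y) * X = 0 \<Longrightarrow> X = 0"
    and "(1 - q * q * (z * y)) * X = 0 \<Longrightarrow> X = 0"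
proof -
  let ?s = "scal (vv TYPE('N) * vv TYPE('N)) :: ('n, 'N) qalg"
  have qq: "q * q = Poly_Mapping.single 0 ?s"
    by (simp add: q_def mult_single scal_mult)
  have inv: "scal (inverse (vv TYPE('N) * vv TYPE('N))) * ?s = 1"
    unfolding scal_mult[symmetric] by (subst left_inverse) (simp_all add: scal_1 vv_nonzero)
  have fst: "fst (x - y) = fst x - fst y" for x y :: "int \<times> int" by simp
  show "(q * q * z - y) * X = 0 \<Longrightarrow> X = 0"
    by (rule binomial_mult_eq_0_imp_eq_0[of "(2,0)" ?s "(0,2)" 1 X fst, OF _ fst _ inv])
      (simp_all add: qq z_def y_def mult_single)
  show "(z - q * q * y) * X = 0 \<Longrightarrow> X = 0"
    by (rule binomial_mult_eq_0_imp_eq_0[of "(2,0)" 1 "(0,2)" ?s X fst, OF _ fst _ _ inv])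
      (simp_all add: qq z_def y_def mult_single)
  show "(q * q - z * y) * X = 0 \<Longrightarrow> X = 0"
    by (rule binomial_mult_eq_0_imp_eq_0[of "0" ?s "(2,2)" 1 X fst, OF _ fst _ inv])
      (simp_all add: qq z_def y_def mult_single)
  show "(1 - q * q * (z * y)) * X = 0 \<Longrightarrow> X = 0"
    by (rule binomial_mult_eq_0_imp_eq_0[of "0" 1 "(2,2)" ?s X fst, OF _ fst _ _ inv])
      (simp_all add: qq z_def y_def mult_single flip: single_one zero_prod_def)
qed

lemma map_mat2_lax_core:
  assumes "\<And>x y. h (x * y) = h x * h y" "\<And>x y. h (x - y) = h x - h y" "\<And>x. h (- x) = - h x" "h 0 = 0"
  shows "map_mat2 h (lax_core s z w w' d d') = lax_core s (h z) (h w) (h w') (h d) (h d')"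
  by (simp add: lax_core_def map_mat2_mat2 assms)

text \<open>Reindexing is a ring homomorphism that fixes constants, so it only replaces the spectral
  parameter in the nested product.\<close>

lemma map_mat2_reindex_lax_monodromy:
  fixes f :: "int \<Rightarrow> 'm::comm_monoid_add"
  assumes f: "\<And>x y. f (x + y) = f x + f y" "f 0 = 0"
  shows "map_mat2 (reindex f) (lax_monodromy k is :: ('n::finite, 'N::finite) zpoly ^ 2 ^ 2) =
    weyl_family.monodromy_core (\<lambda>i. Poly_Mapping.single 0 (w_pow i 1)) (\<lambda>i. Poly_Mapping.single 0 (w_pow i (-1)))
     (\<lambda>i. Poly_Mapping.single 0 (D_pow i 1)) (\<lambda>i. Poly_Mapping.single 0 (D_pow i (-1))) k
     (Poly_Mapping.single (f 2) 1) is"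
proof -
  have "reindex f 1 = (1 :: 'm \<Rightarrow>\<^sub>0 ('n, 'N) qalg)"
    using reindex_single[of f 0 "1 :: ('n, 'N) qalg"] f(2) by simp
  then show ?thesis
    unfolding lax_monodromy_eq weyl_family.monodromy_core_def[OF weyl_family_zpoly]
    by (subst map_mat2_sandwich)
      (simp_all add: reindex_mult reindex_add reindex_diff reindex_minus map_mat2_lax_core f)
qed

text \<open>At first order in \<open>e\<close> only the sum a d + b c has to be symmetric, which is
  the form in which the elimination delivers the mixed relation.\<close>

lemma commute_central_comb:
  fixes a b c d e :: "'r::ring_1"
  assumes e: "central e" and "a * c = c * a" "b * d = d * b" "a * d + b * c = c * b + d * a"
  shows "(a + e * b) * (c + e * d) = (c + e * d) * (a + e * b)"
proof -
  have expand: "(a + e * b) * (c + e * d) = a * c + e * (a * d + b * c) + e * (e * (b * d))" for a b c d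
    by (simp add: distrib_left distrib_right mult.assoc central_left_commute[OF e, of a]
        central_left_commute[OF e, of b] add_ac)
  show ?thesis
    unfolding expand assms(2-4) by (simp add: add_ac)
qed

lemma core_comb_coeffs_commute:
  fixes k :: "nat \<Rightarrow> int" and \<epsilon> :: ratfun
  assumes k: "\<forall>i\<in>{1..CARD('n)}. k i \<in> {-1, 0, 1}"
  defines "P \<equiv> (core_comb k \<epsilon> :: ('n::finite, 'N::finite) zpoly)"
  shows "Poly_Mapping.lookup P a * Poly_Mapping.lookup P b = Poly_Mapping.lookup P b * Poly_Mapping.lookup P a"
proof -
  let ?f = "\<lambda>m. (m, 0 :: int)" and ?g = "Pair (0 :: int) :: int \<Rightarrow> _"
  let ?q = "Poly_Mapping.single 0 (scal (vv TYPE('N))) :: int \<times> int \<Rightarrow>\<^sub>0 ('n, 'N) qalg"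
  let ?z = "Poly_Mapping.single (2, 0) 1 :: int \<times> int \<Rightarrow>\<^sub>0 ('n, 'N) qalg"
  let ?y = "Poly_Mapping.single (0, 2) 1 :: int \<times> int \<Rightarrow>\<^sub>0 ('n, 'N) qalg"
  let ?e = "Poly_Mapping.single 0 (scal \<epsilon>) :: int \<times> int \<Rightarrow>\<^sub>0 ('n, 'N) qalg"
  define V where "V = (lax_monodromy k [1..<Suc CARD('n)] :: ('n, 'N) zpoly ^ 2 ^ 2)"
  \<comment> \<open>The same matrix placed in the first and in the second variable, that is, the
    monodromy at z and at y.\<close>
  define U W where "U = map_mat2 (reindex ?f) V" and "W = map_mat2 (reindex ?g) V"
  have "reflection_params.reflection ?q ?z ?y U W"
    unfolding U_def W_def V_def
    by (subst (1 2) map_mat2_reindex_lax_monodromy, simp_all only: add_Pair add_0_left zero_prod_def[symmetric])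
      (rule weyl_family.reflection_monodromy_core[OF weyl_family_single[OF weyl_family_qalg]];
       use k in \<open>auto intro!: central_single central_closed central_scal\<close>)
  have params: "reflection_params ?q ?z ?y"
    by unfold_locales (auto intro!: central_single central_closed central_scal)
  note R = reflection_params.reflection_commute[OF params \<open>reflection_params.reflection ?q ?z ?y U W\<close>]
  have 1: "U $ 1 $ 1 * W $ 1 $ 1 = W $ 1 $ 1 * U $ 1 $ 1"
    using R(1)[THEN binomial_mult_eq_0D(1), THEN binomial_mult_eq_0D(3)] by simp
  have 2: "U $ 2 $ 2 * W $ 2 $ 2 = W $ 2 $ 2 * U $ 2 $ 2"
    using R(2)[THEN binomial_mult_eq_0D(1), THEN binomial_mult_eq_0D(3)] by simp
  \<comment> \<open>The five binomial factors are cancelled one by one, outermost first.\<close>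
  have 3: "U $ 1 $ 1 * W $ 2 $ 2 + U $ 2 $ 2 * W $ 1 $ 1 = W $ 1 $ 1 * U $ 2 $ 2 + W $ 2 $ 2 * U $ 1 $ 1"
    using R(3)[THEN binomial_mult_eq_0D(1), THEN binomial_mult_eq_0D(1), THEN binomial_mult_eq_0D(2), THEN binomial_mult_eq_0D(3), THEN binomial_mult_eq_0D(4)]
    by (simp add: algebra_simps)
  have e: "central ?e" by (intro central_single central_scal)
  have eq: "reindex h P = reindex h (V $ 1 $ 1) + Poly_Mapping.single (h 0) (scal \<epsilon>) * reindex h (V $ 2 $ 2)"
    if "\<And>x y. h (x + y) = h x + h y" for h :: "int \<Rightarrow> int \<times> int"
    by (simp add: P_def core_comb_def V_def reindex_add reindex_mult that)
  have P: "reindex ?f P = U $ 1 $ 1 + ?e * U $ 2 $ 2" "reindex ?g P = W $ 1 $ 1 + ?e * W $ 2 $ 2"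
    by (simp_all add: eq U_def W_def map_mat2_def zero_prod_def)
  have "reindex ?f P * reindex ?g P = reindex ?g P * reindex ?f P"
    unfolding P by (rule commute_central_comb[OF e 1 2 3])
  then have "Poly_Mapping.lookup (reindex ?f P * reindex ?g P) (a, b)
    = Poly_Mapping.lookup (reindex ?g P * reindex ?f P) (a, b)" by simp
  then show ?thesis by (simp only: lookup_reindex_mult)
qed

section \<open>Parity of the D-degree\<close>

text \<open>The common pattern of \<open>w_pow\<close> and \<open>D_pow\<close>; with the inverse as
  an explicit argument it also covers the barred sites, where the roles are exchanged.\<close>

definition signed_power :: "'r::ring_1 \<Rightarrow> 'r \<Rightarrow> int \<Rightarrow> 'r" where
  "signed_power x x' m = (if m \<ge> 0 then x ^ nat m else x' ^ nat (- m))"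

lemma signed_power_Suc:
  assumes "x * x' = 1"
  shows "signed_power x x' (m + 1) = x * signed_power x x' m"
proof (cases "m \<ge> 0")
  case True
  then show ?thesis by (simp add: signed_power_def nat_add_distrib)
next
  case False
  then have "nat (- m) = Suc (nat (- m - 1))" by simp
  then have "x * signed_power x x' m = x' ^ nat (- m - 1)"
    using False assms by (simp add: signed_power_def mult.assoc[symmetric])
  then show ?thesis using False by (auto simp: signed_power_def)
qed

lemma signed_power_pred:
  assumes "x' * x = 1" "x * x' = 1"
  shows "signed_power x x' (m - 1) = x' * signed_power x x' m"
  using signed_power_Suc[OF assms(2), of "m - 1"] assms(1) by (simp add: mult.assoc[symmetric])

lemma signed_power_add:
  assumes "x * x' = 1" "x' * x = 1"
  shows "signed_power x x' (a + b) = signed_power x x' a * signed_power x x' b"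
proof (induction a rule: int_induct[where k = 0])
  case base
  show ?case by (simp add: signed_power_def)
next
  case (step1 i)
  then show ?case
    using signed_power_Suc[OF assms(1), of i] signed_power_Suc[OF assms(1), of "i + b"]
    by (simp add: mult.assoc add_ac)
next
  case (step2 i)
  then show ?case
    using signed_power_pred[OF assms(2,1), of i] signed_power_pred[OF assms(2,1), of "i + b"]
    by (simp add: mult.assoc algebra_simps)
qed

lemma signed_power_commute:
  assumes "a * x = x * a" "a * x' = x' * a"
  shows "a * signed_power x x' m = signed_power x x' m * (a :: 'r::ring_1)"
  by (simp add: signed_power_def power_commuting_commutes assms)

lemma signed_power_commute2:
  assumes "\<And>a b. a \<in> {x, x'} \<Longrightarrow> b \<in> {y, y'} \<Longrightarrow> a * b = b * (a :: 'r::ring_1)"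
  shows "signed_power x x' a * signed_power y y' b = signed_power y y' b * signed_power x x' a"
  by (intro signed_power_commute signed_power_commute[symmetric])
    (rule assms[symmetric]; simp)+

lemma w_pow_eq: "w_pow i = signed_power (w_pow i 1) (w_pow i (-1))"
  by (rule ext) (simp add: signed_power_def w_pow_def)

lemma D_pow_eq: "D_pow i = signed_power (D_pow i 1) (D_pow i (-1))"
  by (rule ext) (simp add: signed_power_def D_pow_def)

lemma w_pow_add: "w_pow i a * w_pow i b = (w_pow i (a + b) :: ('n::finite, 'N::finite) qalg)"
  by (subst (1 2 3) w_pow_eq) (simp add: signed_power_add pow_simps gen_elt_inverse)

lemma D_pow_add: "D_pow i a * D_pow i b = (D_pow i (a + b) :: ('n::finite, 'N::finite) qalg)"
  by (subst (1 2 3) D_pow_eq) (simp add: signed_power_add pow_simps gen_elt_inverse)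

lemma pow_0 [simp]: "w_pow i 0 = 1" "D_pow i 0 = 1"
  by (simp_all add: w_pow_def D_pow_def)

lemma pow_commute:
  assumes "i \<in> {1..CARD('n)}" "j \<in> {1..CARD('n)}" "i \<noteq> j"
  shows "w_pow i a * w_pow j b = (w_pow j b * w_pow i a :: ('n::finite, 'N::finite) qalg)"
    and "D_pow i a * D_pow j b = (D_pow j b * D_pow i a :: ('n::finite, 'N::finite) qalg)"
    and "D_pow i a * w_pow j b = (w_pow j b * D_pow i a :: ('n::finite, 'N::finite) qalg)"
proof -
  have *: "x * y = y * x" if "x \<in> {w_pow i 1, w_pow i (-1), D_pow i 1, D_pow i (-1)}"
      "y \<in> {w_pow j 1, w_pow j (-1), D_pow j 1, D_pow j (-1)}" for x y :: "('n, 'N) qalg"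
    by (rule weyl_family.commute[OF weyl_family_qalg assms that])
  show "w_pow i a * w_pow j b = (w_pow j b * w_pow i a :: ('n::finite, 'N::finite) qalg)"
    using signed_power_commute2[of "w_pow i 1" "w_pow i (-1)" "w_pow j 1" "w_pow j (-1)" a b, OF *]
    by (auto simp flip: w_pow_eq D_pow_eq)
  show "D_pow i a * D_pow j b = (D_pow j b * D_pow i a :: ('n::finite, 'N::finite) qalg)"
    using signed_power_commute2[of "D_pow i 1" "D_pow i (-1)" "D_pow j 1" "D_pow j (-1)" a b, OF *]
    by (auto simp flip: w_pow_eq D_pow_eq)
  show "D_pow i a * w_pow j b = (w_pow j b * D_pow i a :: ('n::finite, 'N::finite) qalg)"
    using signed_power_commute2[of "D_pow i 1" "D_pow i (-1)" "w_pow j 1" "w_pow j (-1)" a b, OF *]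
    by (auto simp flip: w_pow_eq D_pow_eq)
qed

lemma D_pow_commute:
  assumes "i \<in> {1..CARD('n)}" "j \<in> {1..CARD('n)}"
  shows "D_pow i a * D_pow j b = (D_pow j b * D_pow i a :: ('n::finite, 'N::finite) qalg)"
  using pow_commute(2)[OF assms] by (cases "i = j") (simp_all add: D_pow_add add.commute)

section \<open>Even and odd degree in the D_j\<close>

lemma C_alg_intros:
  fixes x y :: "('n::finite, 'N::finite) qalg"
  shows "scal c \<in> (C_alg :: ('n, 'N) qalg set)"
    and "x \<in> C_alg \<Longrightarrow> y \<in> C_alg \<Longrightarrow> x + y \<in> C_alg"
    and "x \<in> C_alg \<Longrightarrow> y \<in> C_alg \<Longrightarrow> x * y \<in> C_alg"
    and "j \<in> {1..CARD('n)} \<Longrightarrow> s \<in> {1, -1} \<Longrightarrow> w_pow j s \<in> (C_alg :: ('n, 'N) qalg set)"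
    and "1 \<le> i \<Longrightarrow> i < CARD('n) \<Longrightarrow> s \<in> {1, -1} \<Longrightarrow>
      D_pow i s * D_pow (i + 1) (- s) \<in> (C_alg :: ('n, 'N) qalg set)"
    and "s \<in> {2, -2} \<Longrightarrow> D_pow CARD('n) s \<in> (C_alg :: ('n, 'N) qalg set)"
  unfolding C_alg_def Let_def
  by (blast intro: subalgebra_gen.intros)+

lemma C_alg_neg: "x \<in> C_alg \<Longrightarrow> - x \<in> (C_alg :: ('n::finite, 'N::finite) qalg set)"
  using C_alg_intros(3)[OF C_alg_intros(1)[of "- 1"], of x] by (simp add: scal_minus scal_1)

lemma C_alg_diff: "x \<in> C_alg \<Longrightarrow> y \<in> C_alg \<Longrightarrow> x - y \<in> (C_alg :: ('n::finite, 'N::finite) qalg set)"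
  using C_alg_intros(2)[of x "- y"] C_alg_neg[of y] by simp

lemma C_alg_0_1: "0 \<in> (C_alg :: ('n::finite, 'N::finite) qalg set)" "1 \<in> (C_alg :: ('n::finite, 'N::finite) qalg set)"
  using C_alg_intros(1)[of 0] C_alg_intros(1)[of 1] by (simp_all add: scal_0 scal_1)

text \<open>Conjugation by D_n is multiplicative and rescales each generator. This lets D_n be moved
  across elements of C_n when products with the odd part are formed.\<close>

lemma C_alg_conj:
  assumes "x \<in> (C_alg :: ('n::finite, 'N::finite) qalg set)"
  shows "D_pow CARD('n) 1 * x * D_pow CARD('n) (-1) \<in> (C_alg :: ('n, 'N) qalg set)"
proof -
  let ?n = "CARD('n)"
  let ?D = "D_pow ?n 1 :: ('n, 'N) qalg" and ?D' = "D_pow ?n (-1) :: ('n, 'N) qalg"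
  have n: "?n \<in> {1..?n}" using zero_less_card_finite[where 'a = 'n] by simp
  have DD: "?D * ?D' = 1" "?D' * ?D = 1" by (simp_all add: D_pow_add)
  show ?thesis
    using assms unfolding C_alg_def Let_def
  proof (induction x rule: subalgebra_gen.induct)
    case (base x)
    then have x: "x \<in> C_alg"
      unfolding C_alg_def Let_def by (rule subalgebra_gen.base)
    from base consider j s where "x = w_pow j s" "j \<in> {1..?n}" "s \<in> {1, -1}"
      | i s where "x = D_pow i s * D_pow (i + 1) (- s)" "i \<in> {1..?n}" "i + 1 \<in> {1..?n}"
      | s where "x = D_pow ?n s"
      by fastforce
    \<comment> \<open>The scalar is v or its inverse when x is w_n or its inverse, and 1 for all
      other generators.\<close>
    then have "\<exists>c. ?D * x = scal c * (x * ?D)"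
    proof cases
      case 1
      then have "?D * x = scal (if j = ?n then vv TYPE('N) powi s else 1) * (x * ?D)"
        using pow_commute(3)[OF n 1(2)] weyl_pair.dw[OF weyl_family.pair[OF weyl_family_qalg n]]
          weyl_pair.dw'[OF weyl_family.pair[OF weyl_family_qalg n]]
        by (auto simp: scal_1)
      then show ?thesis ..
    next
      case 2
      have "?D * x = scal 1 * (x * ?D)"
        unfolding 2(1) scal_1 mult_1 by (intro commute_mult D_pow_commute n 2)
      then show ?thesis ..
    next
      case 3
      have "?D * x = scal 1 * (x * ?D)"
        unfolding 3 scal_1 mult_1 by (intro D_pow_commute n)
      then show ?thesis ..
    qed
    then obtain c where c: "?D * x = scal c * (x * ?D)" by blast
    have "?D * x * ?D' = scal c * x" unfolding c by (simp add: mult.assoc DD)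
    then show ?case using C_alg_intros(3)[OF C_alg_intros(1) x, of c]
      by (simp only: C_alg_def Let_def)
  next
    case (scalar c)
    have "?D * scal c * ?D' = scal c"
      by (simp add: centralD[OF central_scal, of ?D] mult.assoc DD)
    then show ?case by (simp add: subalgebra_gen.scalar)
  next
    case (add x y)
    then show ?case by (simp add: distrib_left distrib_right subalgebra_gen.add)
  next
    case (mult x y)
    have "?D * (x * y) * ?D' = ?D * x * (?D' * ?D) * y * ?D'" by (simp add: DD mult.assoc)
    also have "\<dots> = (?D * x * ?D') * (?D * y * ?D')" by (simp only: mult.assoc)
    finally show ?case using mult by (simp only: subalgebra_gen.mult)
  qed
qed

text \<open>
  \<open>C_alg\<close> is the part of even total degree in the \<open>D_j\<close>; this is the part of odd total degree.
\<close>

definition odd_part :: "('n::finite, 'N::finite) qalg set" where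
  "odd_part = {x. x * D_pow CARD('n) 1 \<in> C_alg}"

lemma odd_part_mult:
  fixes x y :: "('n::finite, 'N::finite) qalg"
  shows "x \<in> C_alg \<Longrightarrow> y \<in> odd_part \<Longrightarrow> x * y \<in> odd_part"
    and "x \<in> odd_part \<Longrightarrow> y \<in> C_alg \<Longrightarrow> x * y \<in> odd_part"
    and "x \<in> odd_part \<Longrightarrow> y \<in> odd_part \<Longrightarrow> x * y \<in> C_alg"
proof -
  let ?n = "CARD('n)"
  let ?D = "D_pow ?n 1 :: ('n, 'N) qalg" and ?D' = "D_pow ?n (-1) :: ('n, 'N) qalg"
  have DD: "?D * (?D' * u) = u" "?D' * (?D * u) = u" for u by (simp_all add: D_pow_add mult.assoc[symmetric])
  have D2: "D_pow ?n (-2) * (?D * u) = ?D' * u" "u * ?D * D_pow ?n (-2) = u * ?D'"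
    "D_pow ?n 2 * (?D' * u) = ?D * u" for u
    by (simp_all add: D_pow_add mult.assoc[symmetric]) (simp_all add: D_pow_add mult.assoc)
  \<comment> \<open>Conjugation by the inverse of D_n is conjugation by D_n followed by
    multiplication with the squares of D_n and of its inverse, which lie in C_n.\<close>
  have conj': "?D' * (y * ?D) \<in> C_alg" if "y \<in> C_alg" for y
  proof -
    have "D_pow ?n (-2) * (?D * y * ?D') * D_pow ?n 2 \<in> C_alg"
      by (intro C_alg_intros(3,6) C_alg_conj that) simp_all
    then show ?thesis by (simp add: mult.assoc D2 D_pow_add)
  qed
  show "x \<in> C_alg \<Longrightarrow> y \<in> odd_part \<Longrightarrow> x * y \<in> odd_part"
    using C_alg_intros(3)[of x "y * ?D"] by (simp add: odd_part_def mult.assoc)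
  show "x \<in> odd_part \<Longrightarrow> y \<in> C_alg \<Longrightarrow> x * y \<in> odd_part"
    using C_alg_intros(3)[of "x * ?D" "?D' * (y * ?D)"] conj'[of y]
    by (simp add: odd_part_def mult.assoc DD)
  show "x * y \<in> C_alg" if "x \<in> odd_part" "y \<in> odd_part"
  proof -
    have "(x * ?D) * (?D' * ((y * ?D) * ?D)) * D_pow ?n (-2) \<in> C_alg"
      using that by (intro C_alg_intros(3)[OF C_alg_intros(3) C_alg_intros(6)] conj')
        (simp_all add: odd_part_def)
    then show ?thesis by (simp add: mult.assoc DD D2 D_pow_add)
  qed
qed

lemma odd_part_add: "x \<in> odd_part \<Longrightarrow> y \<in> odd_part \<Longrightarrow> x + y \<in> (odd_part :: ('n::finite, 'N::finite) qalg set)"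
  by (simp add: odd_part_def distrib_right C_alg_intros)

lemma odd_part_neg: "x \<in> odd_part \<Longrightarrow> - x \<in> (odd_part :: ('n::finite, 'N::finite) qalg set)"
  by (simp add: odd_part_def C_alg_neg)

text \<open>Descending induction from D_n: D_m^s is the even element D_m^s D_(m+1)^(-s) times
  D_(m+1)^s.\<close>

lemma D_pow_odd_part:
  assumes "j \<in> {1..CARD('n)}" "s \<in> {1, -1}"
  shows "D_pow j s \<in> (odd_part :: ('n::finite, 'N::finite) qalg set)"
proof -
  have "j \<le> CARD('n)" "1 \<le> j" using assms by auto
  then show ?thesis
  proof (induction j rule: inc_induct)
    case base
    show ?case using assms(2) by (auto simp: odd_part_def D_pow_add C_alg_0_1 C_alg_intros)
  next
    case (step m)
    have "D_pow m s * D_pow (m + 1) (- s) * D_pow (m + 1) s \<in> (odd_part :: ('n, 'N) qalg set)"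
      by (intro odd_part_mult(1) C_alg_intros(5)) (use step assms(2) in auto)
    then show ?case by (simp add: mult.assoc D_pow_add)
  qed
qed

lemma lookup_mult_eq_sum:
  fixes p q :: "'m::ab_group_add \<Rightarrow>\<^sub>0 'a::ring_1"
  shows "Poly_Mapping.lookup (p * q) k =
    (\<Sum>m\<in>Poly_Mapping.keys p. Poly_Mapping.lookup p m * Poly_Mapping.lookup q (k - m))"
proof -
  \<comment> \<open>Unfolding \<open>reindex id\<close> writes p as the sum of its
    monomials.\<close>
  have "reindex id p = p"
    by (induction p rule: poly_mapping_single_add_induct) (simp_all add: reindex_add)
  then have "p * q = reindex id p * q" by simp
  then show ?thesis
    by (simp only: reindex_def id_apply sum_distrib_right lookup_sum lookup_single_mult)
qed

definition parity_graded :: "('n::finite, 'N::finite) zpoly ^ 2 ^ 2 \<Rightarrow> bool" where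
  "parity_graded A \<longleftrightarrow> (\<forall>i j m. Poly_Mapping.lookup (A $ i $ j) m \<in> (if i = j then C_alg else odd_part))"

lemma parity_graded_mat2:
  "parity_graded (mat2 a b c d) \<longleftrightarrow> (\<forall>m. Poly_Mapping.lookup a m \<in> C_alg \<and> Poly_Mapping.lookup b m \<in> odd_part
    \<and> Poly_Mapping.lookup c m \<in> odd_part \<and> Poly_Mapping.lookup d m \<in> C_alg)"
  by (auto simp: parity_graded_def forall_2)

lemma odd_part_0: "0 \<in> odd_part"
  by (simp add: odd_part_def C_alg_0_1)

lemma sum_closed:
  assumes "0 \<in> S" "\<And>x y. x \<in> S \<Longrightarrow> y \<in> S \<Longrightarrow> x + y \<in> S" "\<And>i. i \<in> I \<Longrightarrow> f i \<in> S"
  shows "sum f I \<in> S"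
  using assms(3) by (induction I rule: infinite_finite_induct) (auto intro: assms)

lemma parity_graded_mult:
  assumes "parity_graded A" "parity_graded B"
  shows "parity_graded (A ** B)"
  unfolding parity_graded_def matrix_matrix_mult_def vec_lambda_beta lookup_sum lookup_mult_eq_sum
proof (intro allI)
  fix i j :: 2 and m
  let ?G = "if i = j then C_alg else odd_part"
  show "(\<Sum>l\<in>UNIV. \<Sum>k\<in>Poly_Mapping.keys (A $ i $ l). Poly_Mapping.lookup (A $ i $ l) k
      * Poly_Mapping.lookup (B $ l $ j) (m - k)) \<in> ?G"
  proof (intro sum_closed)
    fix l k
    have "Poly_Mapping.lookup (A $ i $ l) k \<in> (if i = l then C_alg else odd_part)"
      "Poly_Mapping.lookup (B $ l $ j) (m - k) \<in> (if l = j then C_alg else odd_part)"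
      using assms unfolding parity_graded_def by blast+
    then show "Poly_Mapping.lookup (A $ i $ l) k * Poly_Mapping.lookup (B $ l $ j) (m - k) \<in> ?G"
      using C_alg_intros(3) odd_part_mult exhaust_2[of i] exhaust_2[of j] exhaust_2[of l]
      by (auto split: if_splits)
  qed (auto simp: C_alg_0_1 odd_part_0 intro: C_alg_intros odd_part_add)
qed

lemma parity_graded_mat_1: "parity_graded (mat 1)"
  by (auto simp: parity_graded_def mat_def lookup_one when_def C_alg_0_1 odd_part_0)

lemma parity_graded_sandwich:
  assumes "\<And>i. i \<in> set is \<Longrightarrow> parity_graded (B i)" "\<And>i. i \<in> set is \<Longrightarrow> parity_graded (L i)"
  shows "parity_graded (sandwich B L is)"
  using assms by (induction "is") (auto intro: parity_graded_mult parity_graded_mat_1)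

lemma parity_graded_lax_core:
  assumes "w \<in> C_alg" "w' \<in> C_alg" "d \<in> odd_part" "d' \<in> odd_part"
  shows "parity_graded (lax_core s (zmon 1 2) (zmon w 0) (zmon w' 0) (zmon d 0) (zmon d' 0))"
  using assms
  by (auto simp: lax_core_def parity_graded_mat2 mult_single lookup_minus lookup_single when_def
     C_alg_0_1 odd_part_0 intro!: C_alg_diff C_alg_neg odd_part_neg odd_part_mult(1))

lemma lax_monodromy_coeffs_in_C_alg:
  assumes "set is \<subseteq> {1..CARD('n)}"
  shows "Poly_Mapping.lookup ((lax_monodromy k is :: ('n::finite, 'N::finite) zpoly ^ 2 ^ 2) $ i $ i) m \<in> C_alg"
proof -
  have "parity_graded (lax_monodromy k is :: ('n, 'N) zpoly ^ 2 ^ 2)"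
    unfolding lax_monodromy_eq using assms
    by (intro parity_graded_sandwich parity_graded_lax_core C_alg_intros D_pow_odd_part) auto
  then show ?thesis
    unfolding parity_graded_def by (elim allE[of _ i] allE[of _ m]) simp
qed

lemma core_comb_coeffs_in_C_alg:
  "Poly_Mapping.lookup (core_comb k \<epsilon> :: ('n::finite, 'N::finite) zpoly) m \<in> C_alg"
  unfolding core_comb_def
  by (auto simp: lookup_add lookup_single_mult intro!: C_alg_intros lax_monodromy_coeffs_in_C_alg)

section \<open>Lowest coefficients\<close>

definition nonneg_even :: "(int \<Rightarrow>\<^sub>0 'a::ring_1) \<Rightarrow> bool" where
  "nonneg_even p \<longleftrightarrow> (\<forall>m\<in>Poly_Mapping.keys p. even m \<and> 0 \<le> m)"

lemma nonneg_even_add: "nonneg_even p \<Longrightarrow> nonneg_even q \<Longrightarrow> nonneg_even (p + q)"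
  unfolding nonneg_even_def using Poly_Mapping.keys_add[of p q] by blast

lemma nonneg_even_minus: "nonneg_even p \<Longrightarrow> nonneg_even (- p)"
  by (simp add: nonneg_even_def)

lemma nonneg_even_single: "even m \<Longrightarrow> 0 \<le> m \<Longrightarrow> nonneg_even (Poly_Mapping.single m a)"
  by (simp add: nonneg_even_def)

lemma nonneg_even_mult:
  assumes "nonneg_even p" "nonneg_even q" shows "nonneg_even (p * q)"
  unfolding nonneg_even_def
proof
  fix m assume "m \<in> Poly_Mapping.keys (p * q)"
  then obtain a b where "a \<in> Poly_Mapping.keys p" "b \<in> Poly_Mapping.keys q" "m = a + b"
    using keys_mult[of p q] by blast
  then show "even m \<and> 0 \<le> m" using assms unfolding nonneg_even_def by auto
qed

text \<open>
  Exponents count half powers, so \<open>lowest p a b\<close> says that \<open>p = a + b z + O(z^2)\<close> with integral powers only.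
\<close>

definition lowest :: "(int \<Rightarrow>\<^sub>0 'a::ring_1) \<Rightarrow> 'a \<Rightarrow> 'a \<Rightarrow> bool" where
  "lowest p a b \<longleftrightarrow> (\<exists>r. nonneg_even r \<and>
    p = Poly_Mapping.single 0 a + Poly_Mapping.single 2 b + Poly_Mapping.single 4 1 * r)"

lemma lowest_add:
  assumes "lowest p a b" "lowest q c d" shows "lowest (p + q) (a + c) (b + d)"
proof -
  obtain r s where "nonneg_even r" "nonneg_even s"
    and "p = Poly_Mapping.single 0 a + Poly_Mapping.single 2 b + Poly_Mapping.single 4 1 * r"
    and "q = Poly_Mapping.single 0 c + Poly_Mapping.single 2 d + Poly_Mapping.single 4 1 * s"
    using assms unfolding lowest_def by blast
  then show ?thesis unfolding lowest_def
    by (intro exI[of _ "r + s"]) (simp add: nonneg_even_add single_add distrib_left)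
qed

lemma lowest_minus: assumes "lowest p a b" shows "lowest (- p) (- a) (- b)"
proof -
  obtain r where "nonneg_even r"
    and "p = Poly_Mapping.single 0 a + Poly_Mapping.single 2 b + Poly_Mapping.single 4 1 * r"
    using assms unfolding lowest_def by blast
  then show ?thesis unfolding lowest_def
    by (intro exI[of _ "- r"]) (simp add: nonneg_even_minus single_uminus)
qed

lemma lowest_mult:
  assumes "lowest p a b" "lowest q c d" shows "lowest (p * q) (a * c) (a * d + b * c)"
proof -
  let ?s = Poly_Mapping.single
  let ?z = "?s 4 1 :: int \<Rightarrow>\<^sub>0 'a"
  obtain r s where rs: "nonneg_even r" "nonneg_even s"
    and p: "p = ?s 0 a + ?s 2 b + ?z * r" and q: "q = ?s 0 c + ?s 2 d + ?z * s"
    using assms unfolding lowest_def by blast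
  note z = central_left_commute[OF central_single_1[of "4 :: int"]]
  have nonneg: "nonneg_even (?s 0 (b * d) + (?s 0 a + ?s 2 b) * s + r * q)"
    unfolding q
    by (intro nonneg_even_add nonneg_even_mult nonneg_even_single rs) auto
  have "p * q = ?s 0 (a * c) + ?s 2 (a * d + b * c) + ?s 4 (b * d) + (?s 0 a + ?s 2 b) * (?z * s) + ?z * r * q"
    unfolding p by (simp add: distrib_right) (simp add: q distrib_left distrib_right mult_single single_add add_ac)
  also have "\<dots> = ?s 0 (a * c) + ?s 2 (a * d + b * c) + ?z * (?s 0 (b * d) + (?s 0 a + ?s 2 b) * s + r * q)"
    unfolding z by (simp add: distrib_left mult_single mult.assoc)
  finally show ?thesis
    using nonneg unfolding lowest_def by blast
qed

lemma lowest_single: "lowest (Poly_Mapping.single 0 a) a 0" "lowest (Poly_Mapping.single 2 a) 0 a"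
  unfolding lowest_def by (rule exI[of _ 0]; simp add: nonneg_even_def)+

definition lowest_mat :: "(int \<Rightarrow>\<^sub>0 'a::ring_1) ^ 2 ^ 2 \<Rightarrow> 'a ^ 2 ^ 2 \<Rightarrow> 'a ^ 2 ^ 2 \<Rightarrow> bool" where
  "lowest_mat A M N \<longleftrightarrow> (\<forall>i j. lowest (A $ i $ j) (M $ i $ j) (N $ i $ j))"

lemma lowest_mat_mat2:
  "lowest_mat (mat2 a b c d) (mat2 a0 b0 c0 d0) (mat2 a1 b1 c1 d1) \<longleftrightarrow>
    lowest a a0 a1 \<and> lowest b b0 b1 \<and> lowest c c0 c1 \<and> lowest d d0 d1"
  by (auto simp: lowest_mat_def forall_2)

lemma mat2_mult: "mat2 a b c d ** mat2 a' b' c' d' =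
    mat2 (a * a' + b * c') (a * b' + b * d') (c * a' + d * c') (c * b' + d * (d' :: 'r::ring_1))"
  by (simp add: vec_eq_iff forall_2 matrix_matrix_mult_def sum_2)

lemma mat2_add: "mat2 a b c d + mat2 a' b' c' d' = mat2 (a + a') (b + b') (c + c') (d + (d' :: 'r::ring_1))"
  by (simp add: vec_eq_iff forall_2)

lemma lowest_mat_mult:
  assumes "lowest_mat A M N" "lowest_mat B P Q"
  shows "lowest_mat (A ** B) (M ** P) (M ** Q + N ** P)"
  unfolding lowest_mat_def
proof (intro allI)
  fix i j
  have "lowest (A $ i $ l * B $ l $ j) (M $ i $ l * P $ l $ j) (M $ i $ l * Q $ l $ j + N $ i $ l * P $ l $ j)" for l
    using assms by (intro lowest_mult) (auto simp: lowest_mat_def)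
  from lowest_add[OF this[of 1] this[of 2]]
  show "lowest ((A ** B) $ i $ j) ((M ** P) $ i $ j) ((M ** Q + N ** P) $ i $ j)"
    by (simp add: matrix_matrix_mult_def sum_2 algebra_simps)
qed

text \<open>The power w^(-s) merges the three off-diagonal shapes w, 1 and w'; apart from it the
  cases differ only in the entry (2,2), which is z w, 0 or -w'.\<close>

lemma lowest_mat_lax_core:
  fixes w :: "'a::ring_1"
  assumes "s \<in> {-1, 0, 1}" "w * w' = 1" "w' * w = 1"
  shows "lowest_mat (lax_core s (Poly_Mapping.single 2 1) (Poly_Mapping.single 0 w) (Poly_Mapping.single 0 w')
      (Poly_Mapping.single 0 d) (Poly_Mapping.single 0 d'))
    (mat2 (- w) 0 (- (signed_power w w' (- s) * d)) (if s = 1 then - w' else 0))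
    (mat2 w' (signed_power w w' (- s) * d') 0 (if s = - 1 then w else 0))"
proof -
  have "lowest (Poly_Mapping.single 2 x - Poly_Mapping.single 0 y) (- y) x"
      "lowest (- Poly_Mapping.single 0 y) (- y) 0" "lowest 0 0 (0 :: 'a)" for x y :: 'a
    using lowest_add[OF lowest_single(2)[of x] lowest_minus[OF lowest_single(1)[of y]]]
      lowest_minus[OF lowest_single(1)[of y]] lowest_single(1)[of "0 :: 'a"] by simp_all
  then show ?thesis
    using assms(1) by (auto simp: lax_core_def lowest_mat_mat2 mult_single signed_power_def
        intro: lowest_single)
qed

section \<open>Sums over strings of sites with equal k\<close>

definition commutes_with_site :: "nat \<Rightarrow> ('n::finite, 'N::finite) qalg \<Rightarrow> bool" where
  "commutes_with_site m x \<longleftrightarrow> (\<forall>a. w_pow m a * x = x * w_pow m a \<and> D_pow m a * x = x * D_pow m a)"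

lemma commutes_with_site_intros:
  fixes x y :: "('n::finite, 'N::finite) qalg"
  shows "commutes_with_site m x \<Longrightarrow> commutes_with_site m y \<Longrightarrow> commutes_with_site m (x + y)"
    and "commutes_with_site m x \<Longrightarrow> commutes_with_site m y \<Longrightarrow> commutes_with_site m (x * y)"
    and "commutes_with_site m (scal c :: ('n, 'N) qalg)"
    and "commutes_with_site m (0 :: ('n, 'N) qalg)"
    and "m \<in> {1..CARD('n)} \<Longrightarrow> j \<in> {1..CARD('n)} \<Longrightarrow> m \<noteq> j \<Longrightarrow> commutes_with_site m (w_pow j a :: ('n, 'N) qalg)"
    and "m \<in> {1..CARD('n)} \<Longrightarrow> j \<in> {1..CARD('n)} \<Longrightarrow> m \<noteq> j \<Longrightarrow> commutes_with_site m (D_pow j a :: ('n, 'N) qalg)"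
proof -
  show "commutes_with_site m x \<Longrightarrow> commutes_with_site m y \<Longrightarrow> commutes_with_site m (x + y)"
    by (simp add: commutes_with_site_def distrib_left distrib_right)
  show "commutes_with_site m x \<Longrightarrow> commutes_with_site m y \<Longrightarrow> commutes_with_site m (x * y)"
    by (simp add: commutes_with_site_def commute_mult)
  show "commutes_with_site m (scal c :: ('n, 'N) qalg)"
    by (simp add: commutes_with_site_def centralD[OF central_scal])
  show "commutes_with_site m (0 :: ('n, 'N) qalg)"
    by (simp add: commutes_with_site_def)
  assume mj: "m \<in> {1..CARD('n)}" "j \<in> {1..CARD('n)}" "m \<noteq> j"
  show "commutes_with_site m (w_pow j a :: ('n, 'N) qalg)"
    by (simp add: commutes_with_site_def pow_commute(1,3)[OF mj])
  show "commutes_with_site m (D_pow j a :: ('n, 'N) qalg)"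
    by (simp add: commutes_with_site_def pow_commute(2)[OF mj]
        pow_commute(3)[OF mj(2,1) mj(3)[symmetric], symmetric])
qed

lemma commutes_with_site_sum:
  "(\<And>i. i \<in> I \<Longrightarrow> commutes_with_site m (f i)) \<Longrightarrow> commutes_with_site m (sum f I)"
  by (induction I rule: infinite_finite_induct) (auto intro: commutes_with_site_intros)

lemma w_prod_Cons: "i \<le> j \<Longrightarrow> w_prod i j e = w_pow i (e i) * w_prod (Suc i) j e"
  by (simp add: w_prod_def upt_conv_Cons del: upt_Suc)

lemma w_prod_single: "w_prod i i e = w_pow i (e i)"
  by (simp add: w_prod_def)

lemma commutes_with_site_w_prod:
  fixes e :: "nat \<Rightarrow> int"
  assumes "m \<in> {1..CARD('n)}" "m < i" "i \<le> j" "j \<le> CARD('n)"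
  shows "commutes_with_site m (w_prod i j e :: ('n::finite, 'N::finite) qalg)"
  using assms(3,2)
proof (induction i rule: inc_induct)
  case base
  then show ?case unfolding w_prod_single using assms by (intro commutes_with_site_intros) auto
next
  case (step l)
  then have l: "l \<le> j" by simp
  show ?case unfolding w_prod_Cons[OF l] using step assms by (intro commutes_with_site_intros step.IH) auto
qed

text \<open>
  For the partial monodromy matrix of the sites \<open>m, \<dots>, n\<close>, normalised to start at \<open>z^0\<close>,
  \<open>tail_sum k 1 m\<close> is minus the \<open>z\<close>-coefficient of the entry \<open>(1, 2)\<close> and
  \<open>v^(-1) tail_sum k (- 1) m\<close> is the constant coefficient of the entry \<open>(2, 1)\<close>.
\<close>

definition tail_sum :: "(nat \<Rightarrow> int) \<Rightarrow> int \<Rightarrow> nat \<Rightarrow> ('n::finite, 'N::finite) qalg" where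
  "tail_sum k s m =
    (\<Sum>j | m \<le> j \<and> j \<le> CARD('n) \<and> (\<forall>l\<in>{m..<j}. k l = s). w_prod m j (\<lambda>l. - k l - s) * D_pow j (-1))
    + (if \<forall>l\<in>{m..CARD('n)}. k l = s
       then scal (vv TYPE('N) powi (- s)) * w_prod m CARD('n) (\<lambda>l. - k l - s) * D_pow CARD('n) 1 else 0)"

lemma commutes_with_site_tail_sum:
  assumes "m \<in> {1..CARD('n)}" "m < i" "i \<le> CARD('n)"
  shows "commutes_with_site m (tail_sum k s i :: ('n::finite, 'N::finite) qalg)"
  unfolding tail_sum_def using assms
  by (auto intro!: commutes_with_site_intros commutes_with_site_sum commutes_with_site_w_prod)

text \<open>The factor of site i commutes past the later sites and extends each string by one. The
  shift from j to j + 1 gives the index ranges of the Hamiltonian; a = 1 serves the terms free of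
  \<epsilon>, a = -1 those with \<epsilon>.\<close>

lemma w_D_tail_sum:
  fixes k :: "nat \<Rightarrow> int"
  assumes "1 \<le> i" "i < CARD('n)"
  shows "w_pow i (- k i - s) * D_pow i a * (tail_sum k s (Suc i) :: ('n::finite, 'N::finite) qalg) =
    (\<Sum>j | i \<le> j \<and> j < CARD('n) \<and> (\<forall>l\<in>{i + 1..j}. k l = s).
       w_prod i (j + 1) (\<lambda>l. - k l - s) * (D_pow i a * D_pow (j + 1) (-1)))
    + (if \<forall>l\<in>{i + 1..CARD('n)}. k l = s
       then scal (vv TYPE('N) powi (- s)) * w_prod i CARD('n) (\<lambda>l. - k l - s) * (D_pow i a * D_pow CARD('n) 1) else 0)"
proof -
  let ?n = "CARD('n)" and ?e = "\<lambda>l. - k l - s"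
  have move: "w_pow i (?e i) * D_pow i a * (w_prod (Suc i) j ?e * x) = w_prod i j ?e * (D_pow i a * (x :: ('n, 'N) qalg))"
    if "i < j" "j \<le> ?n" for j x
  proof -
    have "commutes_with_site i (w_prod (Suc i) j ?e :: ('n, 'N) qalg)"
      by (rule commutes_with_site_w_prod) (use assms that in auto)
    then have "D_pow i a * (w_prod (Suc i) j ?e * x) = w_prod (Suc i) j ?e * (D_pow i a * x)"
      by (simp add: commutes_with_site_def flip: mult.assoc)
    then show ?thesis
      using that by (simp add: w_prod_Cons[of i j] mult.assoc)
  qed
  have "(\<Sum>j | Suc i \<le> j \<and> j \<le> ?n \<and> (\<forall>l\<in>{Suc i..<j}. k l = s).
      w_pow i (?e i) * D_pow i a * (w_prod (Suc i) j ?e * D_pow j (-1)) :: ('n, 'N) qalg)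
    = (\<Sum>j | i \<le> j \<and> j < ?n \<and> (\<forall>l\<in>{i + 1..j}. k l = s).
       w_prod i (j + 1) ?e * (D_pow i a * D_pow (j + 1) (-1)))"
  proof (rule sum.reindex_bij_witness[of _ Suc "\<lambda>j. j - 1"])
    fix j assume j: "j \<in> {j. Suc i \<le> j \<and> j \<le> ?n \<and> (\<forall>l\<in>{Suc i..<j}. k l = s)}"
    then show "Suc (j - 1) = j" by auto
    show "j - 1 \<in> {j. i \<le> j \<and> j < ?n \<and> (\<forall>l\<in>{i + 1..j}. k l = s)}" using j by auto
    show "w_prod i (j - 1 + 1) ?e * (D_pow i a * D_pow (j - 1 + 1) (-1)) =
       w_pow i (?e i) * D_pow i a * (w_prod (Suc i) j ?e * D_pow j (-1) :: ('n, 'N) qalg)"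
      using j by (subst move) auto
  qed (auto simp: less_Suc_eq_le)
  moreover have "w_pow i (?e i) * D_pow i a * (scal c * w_prod (Suc i) ?n ?e * D_pow ?n 1 :: ('n, 'N) qalg)
    = scal c * w_prod i ?n ?e * (D_pow i a * D_pow ?n 1)" for c
    using move[of ?n "D_pow ?n 1"] assms by (simp add: mult.assoc central_left_commute[OF central_scal])
  ultimately show ?thesis
    unfolding tail_sum_def by (simp add: distrib_left sum_distrib_left)
qed

lemma tail_sum_last:
  "(tail_sum k s CARD('n) :: ('n::finite, 'N::finite) qalg) =
    w_pow CARD('n) (- k CARD('n) - s) * D_pow CARD('n) (-1) +
    (if k CARD('n) = s then scal (vv TYPE('N) powi (- s)) * w_pow CARD('n) (- 2 * s) * D_pow CARD('n) 1 else 0)"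
proof -
  have "{j. CARD('n) \<le> j \<and> j \<le> CARD('n) \<and> (\<forall>l\<in>{CARD('n)..<j}. k l = s)} = {CARD('n)}" by auto
  then show ?thesis by (auto simp: tail_sum_def w_prod_single)
qed

text \<open>A string starting at m either ends there or passes m. Passing requires
  \<open>k m = s\<close>, and then the exponent -k_m - s is -2 s.\<close>

lemma tail_sum_rec:
  fixes k :: "nat \<Rightarrow> int"
  assumes "m < CARD('n)"
  shows "(tail_sum k s m :: ('n::finite, 'N::finite) qalg) = w_pow m (- k m - s) * D_pow m (-1) +
    (if k m = s then w_pow m (- 2 * s) * tail_sum k s (Suc m) else 0)"
proof -
  let ?n = "CARD('n)" and ?e = "\<lambda>l. - k l - s"
  let ?J = "\<lambda>m. {j. m \<le> j \<and> j \<le> ?n \<and> (\<forall>l\<in>{m..<j}. k l = s)}"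
  have J: "?J m = insert m (if k m = s then ?J (Suc m) else {})"
  proof (rule set_eqI)
    fix j
    have "(\<forall>l\<in>{m..<j}. k l = s) \<longleftrightarrow> k m = s \<and> (\<forall>l\<in>{Suc m..<j}. k l = s)" if "m < j"
    proof -
      have "{m..<j} = insert m {Suc m..<j}" using that by auto
      then show ?thesis by simp
    qed
    then show "j \<in> ?J m \<longleftrightarrow> j \<in> insert m (if k m = s then ?J (Suc m) else {})"
      using assms by (cases "m < j") auto
  qed
  have all: "(\<forall>l\<in>{m..?n}. k l = s) \<longleftrightarrow> k m = s \<and> (\<forall>l\<in>{Suc m..?n}. k l = s)"
    using assms by (subst atLeastAtMost_insertL[symmetric]) auto
  have "(\<Sum>j\<in>?J (Suc m). w_prod m j ?e * D_pow j (-1) :: ('n, 'N) qalg) =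
    w_pow m (?e m) * (\<Sum>j\<in>?J (Suc m). w_prod (Suc m) j ?e * D_pow j (-1))"
    by (simp add: sum_distrib_left w_prod_Cons mult.assoc)
  then show ?thesis
    using assms unfolding tail_sum_def all J
    by (auto simp: w_prod_single w_prod_Cons[of m ?n] distrib_left mult.assoc
        central_left_commute[OF central_scal])
qed

lemma mat2_eq_iff: "mat2 a b c d = mat2 a' b' c' d' \<longleftrightarrow> a = a' \<and> b = b' \<and> c = c' \<and> d = d'"
  by (auto simp: vec_eq_iff forall_2)

section \<open>Recursion of the lowest coefficients from site to site\<close>

context weyl_pair
begin

text \<open>Here \<open>u\<close> is w^(-\<kappa>), and \<open>b0\<close>, \<open>b1\<close> and
  \<open>l0\<close>, \<open>l1\<close> are the two lowest coefficients of the barred and the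
  unbarred matrix. The entry (2,1) at order z is merely named, because it never feeds back into the
  other entries.\<close>

lemma lowest_coeffs_single_site:
  fixes \<kappa> :: int
  assumes \<kappa>: "\<kappa> \<in> {-1, 0, 1}"
  defines "u \<equiv> (if \<kappa> = -1 then w else if \<kappa> = 0 then 1 else w')"
  defines "b0 \<equiv> mat2 (- w') 0 (- (u * d')) (if \<kappa> = -1 then - w else 0)"
    and "b1 \<equiv> mat2 w (u * d) 0 (if \<kappa> = 1 then w' else 0)"
    and "l0 \<equiv> mat2 (- w) 0 (- (u * d)) (if \<kappa> = 1 then - w' else 0)"
    and "l1 \<equiv> mat2 w' (u * d') 0 (if \<kappa> = -1 then w else 0)"
  shows "b0 ** l0 = mat2 1 0 (q' * (u * w * d' + (if \<kappa> = -1 then q * (w * w) * d else 0))) 0"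
    and "b0 ** l1 + b1 ** l0 = mat2
      (- (w * w + w' * w' + (if \<kappa> = -1 then q else if \<kappa> = 0 then 1 else q') * (u * u) * (d * d)))
      (- (w' * u * d' + (if \<kappa> = 1 then q' * (w' * w') * d else 0)))
      ((b0 ** l1 + b1 ** l0) $ 2 $ 1)
      (- ((if \<kappa> = 0 then 0 else u * u) + (if \<kappa> = -1 then q' else if \<kappa> = 0 then 1 else q) * (u * u) * (d' * d')))"
  unfolding assms(2-6)
  subgoal using \<kappa> by (elim insertE emptyE; simp add: mat2_mult mat2_add mat2_eq_iff; simp only: weyl_normal; simp)
  subgoal using \<kappa> by (elim insertE emptyE; simp add: mat2_mult mat2_add mat2_eq_iff; simp only: weyl_normal; simp)
  done

text \<open>The recursion closes on \<open>a\<close>, \<open>b\<close>, \<open>c\<close>. The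
  entries (1,2) of \<open>b0\<close> and \<open>l0\<close> vanish, which confines \<open>g\<close>
  to the entry (2,1). The entry (2,2) of \<open>b0\<close> is nonzero only for \<kappa> = -1 and
  that of \<open>l0\<close> only for \<kappa> = 1, so \<open>e\<close> drops out of the new entry
  (2,2).\<close>

lemma lowest_coeffs_dress:
  fixes \<kappa> :: int and a b c e g :: 'r
  assumes \<kappa>: "\<kappa> \<in> {-1, 0, 1}"
    and comm: "\<forall>x\<in>{w, w', d, d'}. \<forall>y\<in>{a, b, c}. x * y = y * x"
  defines "u \<equiv> (if \<kappa> = -1 then w else if \<kappa> = 0 then 1 else w')"
  defines "b0 \<equiv> mat2 (- w') 0 (- (u * d')) (if \<kappa> = -1 then - w else 0)"
    and "b1 \<equiv> mat2 w (u * d) 0 (if \<kappa> = 1 then w' else 0)"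
    and "l0 \<equiv> mat2 (- w) 0 (- (u * d)) (if \<kappa> = 1 then - w' else 0)"
    and "l1 \<equiv> mat2 w' (u * d') 0 (if \<kappa> = -1 then w else 0)"
    and "m0 \<equiv> mat2 1 0 (q' * c) 0" and "m1 \<equiv> mat2 (- a) (- b) g (- e)"
  shows "b0 ** m0 ** l0 = mat2 1 0 (q' * (u * w * d' + (if \<kappa> = -1 then w * w * c else 0))) 0"
    and "b0 ** m0 ** l1 + (b0 ** m1 + b1 ** m0) ** l0 = mat2
      (- (w * w + w' * w' + a + (w' * u * d * b + u * w * d * c)))
      (- (w' * u * d' + (if \<kappa> = 1 then w' * w' * b else 0)))
      ((b0 ** m0 ** l1 + (b0 ** m1 + b1 ** m0) ** l0) $ 2 $ 1)
      (- ((if \<kappa> = -1 then q' else if \<kappa> = 0 then 1 else q) * (u * u) * (d' * d')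
         + (if \<kappa> = 1 then q * (w' * w') * d' * b else 0)
         + (if \<kappa> = -1 then q' * (w * w) * d' * c else 0)))"
proof -
  have "x * y = y * x" "x * (y * t) = y * (x * t)" if "x \<in> {w, w', d, d'}" "y \<in> {a, b, c}" for x y t
    using bspec[OF bspec[OF comm that(1)] that(2)] by (simp, metis mult.assoc)
  then have rules:
    "w * y = y * w" "w' * y = y * w'" "d * y = y * d" "d' * y = y * d'"
    "w * (y * t) = y * (w * t)" "w' * (y * t) = y * (w' * t)" "d * (y * t) = y * (d * t)" "d' * (y * t) = y * (d' * t)"
    if "y \<in> {a, b, c}" for y t
    using that by blast+
  have abc: "a \<in> {a, b, c}" "b \<in> {a, b, c}" "c \<in> {a, b, c}" by auto
  note rules' = rules[OF abc(1)] rules[OF abc(2)] rules[OF abc(3)]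
  note central = centralD[OF q(1), of a] centralD[OF q(1), of b] centralD[OF q(1), of c]
    centralD[OF q(2), of a] centralD[OF q(2), of b] centralD[OF q(2), of c]
    central_left_commute[OF q(1), of a] central_left_commute[OF q(1), of b] central_left_commute[OF q(1), of c]
    central_left_commute[OF q(2), of a] central_left_commute[OF q(2), of b] central_left_commute[OF q(2), of c]
  show "b0 ** m0 ** l0 = mat2 1 0 (q' * (u * w * d' + (if \<kappa> = -1 then w * w * c else 0))) 0"
    using \<kappa> unfolding assms(3-)
    by (elim insertE emptyE; simp add: mat2_mult mat2_add mat2_eq_iff; simp only: weyl_normal rules' central; simp)
  show "b0 ** m0 ** l1 + (b0 ** m1 + b1 ** m0) ** l0 = mat2
      (- (w * w + w' * w' + a + (w' * u * d * b + u * w * d * c)))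
      (- (w' * u * d' + (if \<kappa> = 1 then w' * w' * b else 0)))
      ((b0 ** m0 ** l1 + (b0 ** m1 + b1 ** m0) ** l0) $ 2 $ 1)
      (- ((if \<kappa> = -1 then q' else if \<kappa> = 0 then 1 else q) * (u * u) * (d' * d')
         + (if \<kappa> = 1 then q * (w' * w') * d' * b else 0)
         + (if \<kappa> = -1 then q' * (w * w) * d' * c else 0)))"
    using \<kappa> unfolding assms(3-)
    by (elim insertE emptyE; simp add: mat2_mult mat2_add mat2_eq_iff; simp only: weyl_normal rules' central; simp)
qed

end

text \<open>Minus the z-coefficient of the entry (1,1) for the sites m to n. The exponent
  \<open>- k i - (-1)\<close> keeps the second family literally the case s = -1 of the
  first.\<close>

definition diag_sum :: "(nat \<Rightarrow> int) \<Rightarrow> nat \<Rightarrow> ('n::finite, 'N::finite) qalg" where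
  "diag_sum k m =
    (\<Sum>i=m..CARD('n). w_pow i 2 + w_pow i (-2))
    + (\<Sum>i\<in>{m..<CARD('n)}. w_pow i (- k i - 1) * D_pow i 1 * tail_sum k 1 (Suc i)
        + w_pow i (- k i - (-1)) * D_pow i 1 * tail_sum k (-1) (Suc i))
    + scal (vv TYPE('N) powi (- k CARD('n))) * w_pow CARD('n) (- 2 * k CARD('n)) * D_pow CARD('n) 2"

text \<open>Minus the z-coefficient of the entry (2,2). The first summand arises only at m = n,
  where the matrix in the middle is the identity with entry (2,2) equal to 1; for m < n the constant
  coefficient of that entry is 0, and inner sites contribute through \<open>tail_sum\<close>
  alone.\<close>

definition twist_sum :: "(nat \<Rightarrow> int) \<Rightarrow> nat \<Rightarrow> ('n::finite, 'N::finite) qalg" where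
  "twist_sum k m =
    (if m = CARD('n) \<and> k m \<noteq> 0 then w_pow m (- 2 * k m) else 0)
    + scal (vv TYPE('N) powi (k m)) * w_pow m (- 2 * k m) * D_pow m (- 2)
    + (if m < CARD('n) \<and> k m = 1 then scal (vv TYPE('N)) * w_pow m (- 2) * D_pow m (-1) * tail_sum k 1 (Suc m) else 0)
    + (if m < CARD('n) \<and> k m = -1 then scal (vv TYPE('N) powi (-1)) * w_pow m 2 * D_pow m (-1) * tail_sum k (-1) (Suc m) else 0)"

lemma commutes_with_site_diag_sum:
  assumes "m \<in> {1..CARD('n)}" "m < i" "i \<le> CARD('n)"
  shows "commutes_with_site m (diag_sum k i :: ('n::finite, 'N::finite) qalg)"
  unfolding diag_sum_def using assms
  by (auto intro!: commutes_with_site_intros commutes_with_site_sum commutes_with_site_tail_sum)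

lemma diag_sum_last:
  "(diag_sum k CARD('n) :: ('n::finite, 'N::finite) qalg) = w_pow CARD('n) 2 + w_pow CARD('n) (-2)
    + scal (vv TYPE('N) powi (- k CARD('n))) * w_pow CARD('n) (- 2 * k CARD('n)) * D_pow CARD('n) 2"
  by (simp add: diag_sum_def)

lemma diag_sum_rec:
  assumes "m < CARD('n)"
  shows "(diag_sum k m :: ('n::finite, 'N::finite) qalg) = w_pow m 2 + w_pow m (-2) + diag_sum k (Suc m)
    + (w_pow m (- k m - 1) * D_pow m 1 * tail_sum k 1 (Suc m)
        + w_pow m (- k m - (-1)) * D_pow m 1 * tail_sum k (-1) (Suc m))"
proof -
  have "{m..CARD('n)} = insert m {Suc m..CARD('n)}" "{m..<CARD('n)} = insert m {Suc m..<CARD('n)}"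
    using assms by auto
  then show ?thesis by (simp add: diag_sum_def add_ac)
qed

lemma double_pow:
  "w_pow i 2 = w_pow i 1 * (w_pow i 1 :: ('n::finite, 'N::finite) qalg)"
  "w_pow i (-2) = w_pow i (-1) * (w_pow i (-1) :: ('n, 'N) qalg)"
  "D_pow i 2 = D_pow i 1 * (D_pow i 1 :: ('n, 'N) qalg)"
  "D_pow i (-2) = D_pow i (-1) * (D_pow i (-1) :: ('n, 'N) qalg)"
  by (simp_all add: w_pow_add D_pow_add)

lemma upt_Cons_Suc: "m \<le> n \<Longrightarrow> [m..<Suc n] = m # [Suc m..<Suc n]"
  by (simp add: upt_conv_Cons del: upt_Suc)

lemma lowest_mat_Lax:
  fixes \<kappa> :: int and i :: nat
  assumes "\<kappa> \<in> {-1, 0, 1}"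
  defines "u \<equiv> (if \<kappa> = -1 then w_pow i 1 else if \<kappa> = 0 then 1 else w_pow i (-1) :: ('n::finite, 'N::finite) qalg)"
  shows "lowest_mat (lax_core (- \<kappa>) (zmon 1 2) (zmon (w_pow i (-1)) 0) (zmon (w_pow i 1) 0) (zmon (D_pow i (-1)) 0) (zmon (D_pow i 1) 0))
     (mat2 (- w_pow i (-1)) 0 (- (u * D_pow i (-1))) (if \<kappa> = -1 then - w_pow i 1 else 0))
     (mat2 (w_pow i 1) (u * D_pow i 1) 0 (if \<kappa> = 1 then w_pow i (-1) else 0))"
   and "lowest_mat (lax_core \<kappa> (zmon 1 2) (zmon (w_pow i 1) 0) (zmon (w_pow i (-1)) 0) (zmon (D_pow i 1) 0) (zmon (D_pow i (-1)) 0))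
     (mat2 (- w_pow i 1) 0 (- (u * D_pow i 1)) (if \<kappa> = 1 then - w_pow i (-1) else 0))
     (mat2 (w_pow i (-1)) (u * D_pow i (-1)) 0 (if \<kappa> = -1 then w_pow i 1 else 0))"
proof -
  have inv: "w_pow i 1 * w_pow i (-1) = (1 :: ('n, 'N) qalg)" "w_pow i (-1) * w_pow i 1 = (1 :: ('n, 'N) qalg)"
    by (simp_all add: w_pow_add)
  have u: "signed_power (w_pow i (-1)) (w_pow i 1) \<kappa> = u" "signed_power (w_pow i 1) (w_pow i (-1)) (- \<kappa>) = u"
    using assms(1) by (auto simp: u_def signed_power_def)
  show "lowest_mat (lax_core (- \<kappa>) (zmon 1 2) (zmon (w_pow i (-1)) 0) (zmon (w_pow i 1) 0) (zmon (D_pow i (-1)) 0) (zmon (D_pow i 1) 0))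
     (mat2 (- w_pow i (-1)) 0 (- (u * D_pow i (-1))) (if \<kappa> = -1 then - w_pow i 1 else 0))
     (mat2 (w_pow i 1) (u * D_pow i 1) 0 (if \<kappa> = 1 then w_pow i (-1) else 0))"
    using lowest_mat_lax_core[of "- \<kappa>", OF _ inv(2,1), of "D_pow i (-1)" "D_pow i 1"] assms(1)
    by (auto simp: u minus_equation_iff[of \<kappa> 1] minus_equation_iff[of \<kappa> "-1"])
  show "lowest_mat (lax_core \<kappa> (zmon 1 2) (zmon (w_pow i 1) 0) (zmon (w_pow i (-1)) 0) (zmon (D_pow i 1) 0) (zmon (D_pow i (-1)) 0))
     (mat2 (- w_pow i 1) 0 (- (u * D_pow i 1)) (if \<kappa> = 1 then - w_pow i (-1) else 0))
     (mat2 (w_pow i (-1)) (u * D_pow i (-1)) 0 (if \<kappa> = -1 then w_pow i 1 else 0))"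
    using lowest_mat_lax_core[of "\<kappa>", OF _ inv, of "D_pow i 1" "D_pow i (-1)"] assms(1)
    by (simp add: u)
qed

text \<open>Descending induction on m from the innermost site n, each step wrapping site m around
  the monodromy of the later sites. The coefficient \<gamma> stays existential because the recursion
  does not pass it on.\<close>

lemma lax_monodromy_lowest:
  fixes k :: "nat \<Rightarrow> int"
  assumes k: "\<forall>i\<in>{1..CARD('n)}. k i \<in> {-1, 0, 1}" and m: "1 \<le> m" "m \<le> CARD('n)"
  shows "\<exists>\<gamma>. lowest_mat (lax_monodromy k [m..<Suc CARD('n)] :: ('n::finite, 'N::finite) zpoly ^ 2 ^ 2)
    (mat2 1 0 (scal (inverse (vv TYPE('N))) * tail_sum k (-1) m) 0)
    (mat2 (- diag_sum k m) (- tail_sum k 1 m) \<gamma> (- twist_sum k m))"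
  using m(2,1)
proof (induction m rule: inc_induct)
  case base
  let ?n = "CARD('n)"
  have n: "?n \<in> {1..?n}" using base by simp
  interpret weyl_pair "scal (vv TYPE('N)) :: ('n, 'N) qalg" "scal (inverse (vv TYPE('N)))"
    "w_pow ?n 1" "w_pow ?n (-1)" "D_pow ?n 1" "D_pow ?n (-1)"
    by (rule weyl_family.pair[OF weyl_family_qalg n])
  have \<kappa>: "k ?n \<in> {-1, 0, 1}" using k n by blast
  define u :: "('n, 'N) qalg" where "u = (if k ?n = -1 then w_pow ?n 1 else if k ?n = 0 then 1 else w_pow ?n (-1))"
  define b0 where "b0 = mat2 (- w_pow ?n (-1)) 0 (- (u * D_pow ?n (-1))) (if k ?n = -1 then - w_pow ?n 1 else 0)"
  define b1 where "b1 = mat2 (w_pow ?n 1) (u * D_pow ?n 1) 0 (if k ?n = 1 then w_pow ?n (-1) else 0)"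
  define l0 where "l0 = mat2 (- w_pow ?n 1) 0 (- (u * D_pow ?n 1)) (if k ?n = 1 then - w_pow ?n (-1) else 0)"
  define l1 where "l1 = mat2 (w_pow ?n (-1)) (u * D_pow ?n (-1)) 0 (if k ?n = -1 then w_pow ?n 1 else 0)"
  note lax = lowest_mat_Lax[OF \<kappa>, where i = ?n and ?'n = 'n and ?'N = 'N, folded u_def, folded b0_def b1_def l0_def l1_def]
  have one: "lowest_mat (mat 1) (mat 1) (0 :: ('n, 'N) qalg ^ 2 ^ 2)"
    using lowest_single(1)[of "0 :: ('n, 'N) qalg"] lowest_single(1)[of "1 :: ('n, 'N) qalg"]
    by (simp add: lowest_mat_def mat_def)
  have zero: "A ** 0 = 0" for A :: "('n, 'N) qalg ^ 2 ^ 2"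
    by (simp add: vec_eq_iff matrix_matrix_mult_def)
  have L: "lowest_mat (lax_monodromy k [?n..<Suc ?n]) (b0 ** l0) (b0 ** l1 + b1 ** l0)"
    using lowest_mat_mult[OF lowest_mat_mult[OF lax(1) one] lax(2)]
    unfolding lax_monodromy_eq by (simp add: zero)
  note E = lowest_coeffs_single_site[OF \<kappa>, folded u_def, folded b0_def b1_def l0_def l1_def]
  have "b0 ** l0 = mat2 1 0 (scal (inverse (vv TYPE('N))) * tail_sum k (-1) ?n) 0"
    unfolding E(1) using \<kappa> by (auto simp: mat2_eq_iff tail_sum_last double_pow u_def inv)
  moreover have "b0 ** l1 + b1 ** l0 = mat2 (- diag_sum k ?n) (- tail_sum k 1 ?n) ((b0 ** l1 + b1 ** l0) $ 2 $ 1) (- twist_sum k ?n)"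
    using \<kappa> by (subst E(2)) (auto simp: mat2_eq_iff tail_sum_last diag_sum_last twist_sum_def double_pow u_def scal_1
      power_int_minus add_ac inv)
  ultimately show ?case
    using L by metis
next
  case (step m)
  let ?n = "CARD('n)"
  have m: "m \<in> {1..?n}" using step by simp
  interpret weyl_pair "scal (vv TYPE('N)) :: ('n, 'N) qalg" "scal (inverse (vv TYPE('N)))"
    "w_pow m 1" "w_pow m (-1)" "D_pow m 1" "D_pow m (-1)"
    by (rule weyl_family.pair[OF weyl_family_qalg m])
  have \<kappa>: "k m \<in> {-1, 0, 1}" using k m by blast
  define u :: "('n, 'N) qalg" where "u = (if k m = -1 then w_pow m 1 else if k m = 0 then 1 else w_pow m (-1))"
  define b0 where "b0 = mat2 (- w_pow m (-1)) 0 (- (u * D_pow m (-1))) (if k m = -1 then - w_pow m 1 else 0)"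
  define b1 where "b1 = mat2 (w_pow m 1) (u * D_pow m 1) 0 (if k m = 1 then w_pow m (-1) else 0)"
  define l0 where "l0 = mat2 (- w_pow m 1) 0 (- (u * D_pow m 1)) (if k m = 1 then - w_pow m (-1) else 0)"
  define l1 where "l1 = mat2 (w_pow m (-1)) (u * D_pow m (-1)) 0 (if k m = -1 then w_pow m 1 else 0)"
  note lax = lowest_mat_Lax[OF \<kappa>, where i = m and ?'n = 'n and ?'N = 'N, folded u_def, folded b0_def b1_def l0_def l1_def]
  define m0 where "m0 = mat2 1 0 (scal (inverse (vv TYPE('N))) * (tail_sum k (-1) (Suc m) :: ('n, 'N) qalg)) 0"
  obtain g where IH: "lowest_mat (lax_monodromy k [Suc m..<Suc ?n]) m0
     (mat2 (- diag_sum k (Suc m)) (- tail_sum k 1 (Suc m)) g (- twist_sum k (Suc m)))"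
    using step.IH step.prems unfolding m0_def by auto
  define m1 where "m1 = mat2 (- diag_sum k (Suc m)) (- tail_sum k 1 (Suc m)) g (- twist_sum k (Suc m))"
  let ?N = "b0 ** m0 ** l1 + (b0 ** m1 + b1 ** m0) ** l0"
  have L: "lowest_mat (lax_monodromy k [m..<Suc ?n]) (b0 ** m0 ** l0) ?N"
    using lowest_mat_mult[OF lowest_mat_mult[OF lax(1) IH[folded m1_def]] lax(2)] step.hyps
    unfolding lax_monodromy_eq upt_Cons_Suc[OF less_imp_le[OF step.hyps(2)]] by simp
  have "commutes_with_site m y" if "y \<in> {diag_sum k (Suc m), tail_sum k 1 (Suc m), tail_sum k (-1) (Suc m)}"
    for y :: "('n, 'N) qalg"
    using that m step.hyps by (auto intro: commutes_with_site_diag_sum commutes_with_site_tail_sum)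
  then have comm: "\<forall>x\<in>{w_pow m 1, w_pow m (-1), D_pow m 1, D_pow m (-1)}.
    \<forall>y\<in>{diag_sum k (Suc m), tail_sum k 1 (Suc m), tail_sum k (-1) (Suc m)}. x * y = y * (x :: ('n, 'N) qalg)"
    unfolding commutes_with_site_def by blast
  note E = lowest_coeffs_dress(1)[OF \<kappa> comm, folded u_def, folded b0_def l0_def m0_def]
    lowest_coeffs_dress(2)[OF \<kappa> comm, where g = g and e = "twist_sum k (Suc m)", folded u_def,
      folded b0_def b1_def l0_def l1_def m0_def m1_def]
  have "b0 ** m0 ** l0 = mat2 1 0 (scal (inverse (vv TYPE('N))) * tail_sum k (-1) m) 0"
    unfolding E(1) using \<kappa> step.hyps by (auto simp: mat2_eq_iff tail_sum_rec double_pow u_def inv)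
  moreover have "?N = mat2 (- diag_sum k m) (- tail_sum k 1 m) (?N $ 2 $ 1) (- twist_sum k m)"
    using \<kappa> step.hyps by (subst E(2)) (auto simp: mat2_eq_iff tail_sum_rec diag_sum_rec twist_sum_def double_pow u_def scal_1
      power_int_minus add_ac inv)
  ultimately show ?case
    using L by metis
qed

section \<open>Identification with the Hamiltonian\<close>

lemma sum_triangle_split:
  fixes g :: "nat \<Rightarrow> nat \<Rightarrow> 'a::comm_monoid_add"
  assumes "\<And>i. P i i"
  shows "(\<Sum>i\<in>{1..<n}. \<Sum>j | i \<le> j \<and> j < n \<and> P i j. g i j) =
    (\<Sum>i\<in>{1..<n}. g i i) + (\<Sum>(i, j)\<in>{(i, j). 1 \<le> i \<and> i < j \<and> j < n \<and> P i j}. g i j)"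
proof -
  have "{j. i \<le> j \<and> j < n \<and> P i j} = insert i {j. i < j \<and> j < n \<and> P i j}" if "i \<in> {1..<n}" for i
    using that assms by (auto simp: order_le_less)
  then have "(\<Sum>i\<in>{1..<n}. \<Sum>j | i \<le> j \<and> j < n \<and> P i j. g i j)
    = (\<Sum>i\<in>{1..<n}. g i i) + (\<Sum>i\<in>{1..<n}. \<Sum>j | i < j \<and> j < n \<and> P i j. g i j)"
    by (simp add: sum.distrib)
  also have "(\<Sum>i\<in>{1..<n}. \<Sum>j | i < j \<and> j < n \<and> P i j. g i j)
    = (\<Sum>(i, j)\<in>{(i, j). 1 \<le> i \<and> i < j \<and> j < n \<and> P i j}. g i j)"
    by (subst sum.Sigma) (auto intro!: sum.cong)
  finally show ?thesis .
qed

text \<open>The diagonal j = i, where the condition on k is vacuous, yields the nearest-neighbour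
  terms; j > i yields the longer strings, and the last summand of \<open>tail_sum\<close> the terms
  with D_i D_n.\<close>

lemma sum_w_D_tail_sum:
  fixes k :: "nat \<Rightarrow> int"
  shows "(\<Sum>i\<in>{1..<CARD('n)}. w_pow i (- k i - s) * D_pow i 1 * tail_sum k s (Suc i) :: ('n::finite, 'N::finite) qalg) =
    (\<Sum>i\<in>{1..<CARD('n)}. w_pow i (- k i - s) * w_pow (i + 1) (- k (i + 1) - s) * (D_pow i 1 * D_pow (i + 1) (- 1)))
    + (\<Sum>(i, j)\<in>{(i, j). 1 \<le> i \<and> i < j \<and> j < CARD('n) \<and> (\<forall>l\<in>{i + 1..j}. k l = s)}.
         w_prod i (j + 1) (\<lambda>l. - k l - s) * (D_pow i 1 * D_pow (j + 1) (- 1)))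
    + (\<Sum>i\<in>{i. 1 \<le> i \<and> i < CARD('n) \<and> (\<forall>l\<in>{i + 1..CARD('n)}. k l = s)}.
         scal (vv TYPE('N) powi (- s)) * w_prod i CARD('n) (\<lambda>l. - k l - s) * (D_pow i 1 * D_pow CARD('n) 1))"
proof -
  have I: "{i. 1 \<le> i \<and> i < CARD('n) \<and> (\<forall>l\<in>{i + 1..CARD('n)}. k l = s)}
    = {i \<in> {1..<CARD('n)}. \<forall>l\<in>{i + 1..CARD('n)}. k l = s}" by auto
  have "(\<Sum>i\<in>{1..<CARD('n)}. w_pow i (- k i - s) * D_pow i 1 * tail_sum k s (Suc i) :: ('n, 'N) qalg)
    = (\<Sum>i\<in>{1..<CARD('n)}. (\<Sum>j | i \<le> j \<and> j < CARD('n) \<and> (\<forall>l\<in>{i + 1..j}. k l = s).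
       w_prod i (j + 1) (\<lambda>l. - k l - s) * (D_pow i 1 * D_pow (j + 1) (-1)))
    + (if \<forall>l\<in>{i + 1..CARD('n)}. k l = s
       then scal (vv TYPE('N) powi (- s)) * w_prod i CARD('n) (\<lambda>l. - k l - s) * (D_pow i 1 * D_pow CARD('n) 1) else 0))"
    by (intro sum.cong refl w_D_tail_sum) auto
  also have "\<dots> = (\<Sum>i\<in>{1..<CARD('n)}. w_prod i (i + 1) (\<lambda>l. - k l - s) * (D_pow i 1 * D_pow (i + 1) (-1)))
    + (\<Sum>(i, j)\<in>{(i, j). 1 \<le> i \<and> i < j \<and> j < CARD('n) \<and> (\<forall>l\<in>{i + 1..j}. k l = s)}.
         w_prod i (j + 1) (\<lambda>l. - k l - s) * (D_pow i 1 * D_pow (j + 1) (- 1)))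
    + (\<Sum>i\<in>{i. 1 \<le> i \<and> i < CARD('n) \<and> (\<forall>l\<in>{i + 1..CARD('n)}. k l = s)}.
         scal (vv TYPE('N) powi (- s)) * w_prod i CARD('n) (\<lambda>l. - k l - s) * (D_pow i 1 * D_pow CARD('n) 1))"
    unfolding sum.distrib I sum.inter_filter[OF finite_atLeastLessThan, symmetric] by (subst sum_triangle_split) auto
  finally show ?thesis
    by (simp add: w_prod_Cons w_prod_single)
qed

lemma w_prod_cong: "(\<And>l. i \<le> l \<Longrightarrow> l \<le> j \<Longrightarrow> e l = f l) \<Longrightarrow> w_prod i j e = w_prod i j f"
  unfolding w_prod_def by (rule arg_cong[of _ _ prod_list], rule map_cong) auto

lemma twist_tail_sum:
  fixes k :: "nat \<Rightarrow> int"
  shows "(if 1 < CARD('n) \<and> k 1 = s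
      then scal (vv TYPE('N) powi s) * w_pow 1 (- 2 * s) * D_pow 1 (-1) * tail_sum k s (Suc 1) else 0 :: ('n::finite, 'N::finite) qalg)
    = (if CARD('n) > 1 \<and> (\<forall>i\<in>{1..CARD('n)}. k i = s)
         then w_prod 1 CARD('n) (\<lambda>_. - 2 * s) * (D_pow CARD('n) 1 * D_pow 1 (- 1)) else 0)
    + (\<Sum>i\<in>{i. 1 \<le> i \<and> i < CARD('n) \<and> (\<forall>l\<in>{1..i}. k l = s)}.
           scal (vv TYPE('N) powi s) * w_prod 1 (i + 1) (\<lambda>l. - k l - s) * (D_pow 1 (- 1) * D_pow (i + 1) (- 1)))"
proof (cases "1 < CARD('n) \<and> k 1 = s")
  case True
  let ?n = "CARD('n)" and ?v = "vv TYPE('N)"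
  have n: "1 \<in> {1..?n}" "?n \<in> {1..?n}" using True by auto
  have insert: "{1..j} = insert 1 {1 + 1..j}" if "1 \<le> j" for j :: nat
    using that by auto
  \<comment> \<open>The assumption \<open>k 1 = s\<close> extends the condition on the later sites
    to one that includes site 1.\<close>
  have all: "(\<forall>l\<in>{1 + 1..j}. k l = s) \<longleftrightarrow> (\<forall>l\<in>{1..j}. k l = s)" if "1 \<le> j" for j
    by (subst insert[OF that]) (use True in auto)
  \<comment> \<open>The weight v^s cancels the weight v^(-s) of the last summand of
    \<open>tail_sum\<close>, so D_n / D_1 appears without a power of v.\<close>
  have vv: "scal (?v powi s) * (scal (?v powi - s) * x) = x" for x :: "('n, 'N) qalg"
    by (simp add: power_int_minus vv_nonzero scal_1 flip: scal_mult mult.assoc)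
  have w: "w_prod 1 ?n (\<lambda>l. - k l - s) = (w_prod 1 ?n (\<lambda>_. - 2 * s) :: ('n, 'N) qalg)"
    if "\<forall>l\<in>{1..?n}. k l = s"
    by (rule w_prod_cong) (use that in auto)
  have "scal (?v powi s) * w_pow 1 (- 2 * s) * D_pow 1 (-1) * tail_sum k s (Suc 1)
    = scal (?v powi s) * (w_pow 1 (- k 1 - s) * D_pow 1 (-1) * tail_sum k s (Suc 1) :: ('n, 'N) qalg)"
    using True by (simp add: mult.assoc)
  also have "w_pow 1 (- k 1 - s) * D_pow 1 (-1) * tail_sum k s (Suc 1) =
    (\<Sum>j | 1 \<le> j \<and> j < ?n \<and> (\<forall>l\<in>{1..j}. k l = s).
       w_prod 1 (j + 1) (\<lambda>l. - k l - s) * (D_pow 1 (-1) * D_pow (j + 1) (-1)))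
    + (if \<forall>l\<in>{1..?n}. k l = s
       then scal (?v powi (- s)) * w_prod 1 ?n (\<lambda>l. - k l - s) * (D_pow 1 (-1) * D_pow ?n 1) else 0 :: ('n, 'N) qalg)"
    using all True by (subst w_D_tail_sum) (auto intro!: sum.cong arg_cong2[of _ _ _ _ "(+)"])
  finally show ?thesis
    using True by (simp add: distrib_left sum_distrib_left mult.assoc vv w D_pow_commute[OF n] add.commute del: One_nat_def)
next
  case False
  then have "{i. 1 \<le> i \<and> i < CARD('n) \<and> (\<forall>l\<in>{1..i}. k l = s)} = {}"
    and "\<not> (CARD('n) > 1 \<and> (\<forall>i\<in>{1..CARD('n)}. k i = s))"
    by auto
  with False show ?thesis by (simp only: if_False sum.empty add_0)
qed

lemma H2hat_eq:
  "(H2hat k \<epsilon> :: ('n::finite, 'N::finite) qalg) = diag_sum k 1 + scal \<epsilon> * twist_sum k 1"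
proof -
  have numerals: "- 2 * (- 1) = (2 :: int)" "- 2 * 1 = (- 2 :: int)" by simp_all
  note norm = diff_minus_eq_add minus_minus power_int_1_right numerals
  note sums = sum_w_D_tail_sum[of k 1, where ?'n = 'n and ?'N = 'N, unfolded norm]
    sum_w_D_tail_sum[of k "-1", where ?'n = 'n and ?'N = 'N, unfolded norm]
    twist_tail_sum[of k 1, where ?'n = 'n and ?'N = 'N, unfolded norm]
    twist_tail_sum[of k "-1", where ?'n = 'n and ?'N = 'N, unfolded norm]
  show ?thesis
    unfolding H2hat_def Let_def diag_sum_def twist_sum_def norm sum.distrib distrib_right sums
      eq_commute[of 1 "CARD('n)"]
    by (simp only: add_ac)
qed

lemma core_comb_lowest:
  assumes "\<forall>i\<in>{1..CARD('n)}. k i \<in> {-1, 0, 1}"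
  shows "lowest (core_comb k \<epsilon> :: ('n::finite, 'N::finite) zpoly) 1 (- H2hat k \<epsilon>)"
proof -
  let ?V = "lax_monodromy k [1..<Suc CARD('n)] :: ('n, 'N) zpoly ^ 2 ^ 2"
  obtain g where "lowest_mat ?V
    (mat2 1 0 (scal (inverse (vv TYPE('N))) * tail_sum k (-1) 1) 0)
    (mat2 (- diag_sum k 1) (- tail_sum k 1 1) g (- twist_sum k 1))"
    using lax_monodromy_lowest[OF assms, of 1] zero_less_card_finite[where 'a = 'n] by auto
  then have "lowest (?V $ 1 $ 1) 1 (- diag_sum k 1)" "lowest (?V $ 2 $ 2) 0 (- twist_sum k 1)"
    by (auto simp: lowest_mat_def forall_2)
  from lowest_add[OF this(1) lowest_mult[OF lowest_single(1)[of "scal \<epsilon>"] this(2)]]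
  show ?thesis by (simp add: core_comb_def H2hat_eq)
qed

theorem proposition3p33:
  fixes k :: "nat \<Rightarrow> int" and \<epsilon> :: ratfun
    and n :: nat and P :: "('n::finite, 'N::finite) zpoly"
    and coeffs :: "('n, 'N) qalg set"
  assumes n: "n = CARD('n)"
    and k: "\<forall>i\<in>{1..n}. k i \<in> {-1, 0, 1}"
    and P: "P = T_comb k \<epsilon>"
    and coeffs: "coeffs = {Poly_Mapping.lookup P m | m. True}"
  shows "(\<forall>x\<in>subalgebra_gen coeffs. \<forall>y\<in>subalgebra_gen coeffs. x * y = y * x)
    \<and> coeffs \<subseteq> C_alg
    \<and> (\<exists>R. P = zmon 1 (2 * (- int n)) - zmon (H2hat k \<epsilon>) (2 * (- int n + 1)) + R
           \<and> (\<forall>m\<in>Poly_Mapping.keys R. \<exists>p. m = 2 * p \<and> p > - int n + 1))"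
proof (intro conjI)
  have k': "\<forall>i\<in>{1..CARD('n)}. k i \<in> {-1, 0, 1}" using k n by simp
  have P_core: "P = zmon 1 (- 2 * int n) * core_comb k \<epsilon>"
    unfolding P T_comb_eq[OF k'] n ..
  then have lookup_P: "Poly_Mapping.lookup P m = Poly_Mapping.lookup (core_comb k \<epsilon>) (m - - 2 * int n)" for m
    by (simp only: lookup_single_mult mult_1)
  have comm: "x * y = y * x" if "x \<in> coeffs" "y \<in> coeffs" for x y
    using that core_comb_coeffs_commute[OF k'] unfolding coeffs lookup_P by blast
  \<comment> \<open>The elements commuting with a fixed one form a subalgebra, so the generated
    subalgebra is reached in one argument at a time.\<close>
  have comm1: "x * y = y * x" if "x \<in> subalgebra_gen coeffs" "y \<in> coeffs" for x y
    using that(1)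
  proof (induction rule: subalgebra_gen.induct)
    case (mult x x')
    then show ?case by (metis mult.assoc)
  qed (simp_all add: comm that(2) distrib_left distrib_right centralD[OF central_scal, of y])
  show "\<forall>x\<in>subalgebra_gen coeffs. \<forall>y\<in>subalgebra_gen coeffs. x * y = y * x"
  proof (intro ballI)
    fix x y assume x: "x \<in> subalgebra_gen coeffs" and "y \<in> subalgebra_gen coeffs"
    from this(2) show "x * y = y * x"
    proof (induction rule: subalgebra_gen.induct)
      case (mult y y')
      then show ?case by (metis mult.assoc)
    qed (simp_all add: comm1[OF x] distrib_left distrib_right centralD[OF central_scal, of x])
  qed
  show "coeffs \<subseteq> C_alg"
    unfolding coeffs lookup_P by (auto intro: core_comb_coeffs_in_C_alg)
  obtain r where r: "nonneg_even r"
    "core_comb k \<epsilon> = zmon 1 0 + zmon (- H2hat k \<epsilon> :: ('n, 'N) qalg) 2 + zmon 1 4 * r"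
    using core_comb_lowest[OF k'] unfolding lowest_def by blast
  \<comment> \<open>In powers of z the remainder is z^(2-n) r, which starts one step above the
    Hamiltonian term.\<close>
  define R where "R = zmon 1 (4 - 2 * int n) * r"
  have "P = zmon 1 (2 * (- int n)) - zmon (H2hat k \<epsilon>) (2 * (- int n + 1)) + R"
    unfolding P_core r(2) R_def
    by (simp add: distrib_left mult_single single_uminus algebra_simps flip: mult.assoc)
  moreover have "\<forall>m\<in>Poly_Mapping.keys R. \<exists>p. m = 2 * p \<and> p > - int n + 1"
  proof
    fix m assume "m \<in> Poly_Mapping.keys R"
    then have "m - (4 - 2 * int n) \<in> Poly_Mapping.keys r"
      by (simp add: R_def in_keys_iff lookup_single_mult)
    then have "even (m - (4 - 2 * int n))" "0 \<le> m - (4 - 2 * int n)"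
      using r(1) unfolding nonneg_even_def by blast+
    then show "\<exists>p. m = 2 * p \<and> p > - int n + 1"
      by (intro exI[of _ "m div 2"]) auto
  qed
  ultimately show "\<exists>R. P = zmon 1 (2 * (- int n)) - zmon (H2hat k \<epsilon>) (2 * (- int n + 1)) + R
           \<and> (\<forall>m\<in>Poly_Mapping.keys R. \<exists>p. m = 2 * p \<and> p > - int n + 1)"
    by blast
qed

end
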